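(* (a) If $k\ge 2$ and $d\ge 2k-3$ are integers, there is a constant $K_{d,k}$ such that for all $n\ge 1$, $$\left|f(n,d,k)-\left(1+\frac{k-1}{d-k+2}\right)n\right|\le K_{d,k}.$$ (b) If $k\ge 3$ and $d$ are integers with $k-2\le d\le 2k-3$, there is a constant $K_{d,k}$ such that for all $n\ge 1$, $$\left|f(n,d,k)-\left(2+\frac{2k-3-d}{2d+3-k}\right)n\right|\le K_{d,k}.$$
   Context: For integers $d\ge 1$, $n\ge 1$, $T_d(n)=\{(x_1,\dots,x_d)\in\mathbb{Z}_{\ge 0}^d : x_1+\dots+x_d\le n-1\}$. A $k$-cover of $T_d(n)$ is a finite multiset of affine hyperplanes in $\mathbb{R}^d$ such that every point of $T_d(n)$ lies in at least $k$ of them (with multiplicity). $f(n,d,k)$ is the minimum cardinality of a $k$-cover of $T_d(n)$. *)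

theory Defs
  imports Main "HOL-Library.Multiset" Complex_Main
begin

definition Rd :: "nat \<Rightarrow> (nat \<Rightarrow> real) set" where
  "Rd d = {x. \<forall>i\<ge>d. x i = 0}"

definition affine_hyperplanes :: "nat \<Rightarrow> (nat \<Rightarrow> real) set set" where
  "affine_hyperplanes d = {{x \<in> Rd d. (\<Sum>i<d. a i * x i) = b} | a b. \<exists>i<d. a i \<noteq> 0}"

definition Tset :: "nat \<Rightarrow> nat \<Rightarrow> (nat \<Rightarrow> real) set" where
  "Tset d n = {(\<lambda>i. real (y i)) | y. (\<forall>i\<ge>d. y i = 0) \<and> (\<Sum>i<d. y i) + 1 \<le> n}"

definition is_kcover :: "nat \<Rightarrow> nat \<Rightarrow> nat \<Rightarrow> (nat \<Rightarrow> real) set multiset \<Rightarrow> bool" where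
  "is_kcover n d k H \<longleftrightarrow> set_mset H \<subseteq> affine_hyperplanes d \<and>
     (\<forall>p \<in> Tset d n. size (filter_mset (\<lambda>h. p \<in> h) H) \<ge> k)"

definition fcov :: "nat \<Rightarrow> nat \<Rightarrow> nat \<Rightarrow> nat" where
  "fcov n d k = (LEAST m. \<exists>H. is_kcover n d k H \<and> size H = m)"

end

theory Submission
  imports Defs
begin

text \<open>
  With a slack coordinate, the points become the nonnegative integer vectors with \<open>D = d + 1\<close> coordinates and sum
  \<open>n - 1\<close>, and the hyperplanes become level sets of linear forms that are not constant on the coordinates.
  Covers of the right size consist of coordinate hyperplanes \<open>x i = c\<close> with multiplicities decreasing in \<open>c\<close>.

  The lower bound has two extreme cases: slope 2 for \<open>D = 2 k - 2\<close> and slope 3 for \<open>D = k - 1\<close>. Both are proved by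
  passing from \<open>D\<close> to \<open>D - 2\<close>, removing a pair of coordinates. For this induction the statement is made robust:
  every line in a direction \<open>e r - e s\<close> may have a total deficit of \<open>\<epsilon>\<close>, at a cost of \<open>2 \<epsilon>\<close> planes. All other slopes
  follow by passing from \<open>D\<close> to \<open>D - 1\<close>: either each coordinate has many hyperplanes \<open>x i = c\<close> of its own, or
  for some \<open>i\<close> there is a small \<open>c\<close> such that the slice \<open>x i = c\<close> is covered, up to at most one unit of the demand, by the
  hyperplanes not of this form.
\<close>

text \<open>The extreme cases are ties between constructions. With multiplicities
  \<open>s - c div m\<close> the slope is \<open>D * s * (s + 1) / 2\<close> divided by
  \<open>s * D + 1 - k\<close>. The values for \<open>s\<close> and \<open>s + 1\<close> agree when
  \<open>s * D = 2 * (k - 1)\<close>, and both are then \<open>s + 1\<close>: slope 2 at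
  \<open>D = 2 * k - 2\<close>, slope 3 at \<open>D = k - 1\<close>. When a pair
  \<open>p, p'\<close> is split off, a slice \<open>x p + x p' = c\<close> is a segment times a
  smaller simplex. The obstacle is a plane that contains a whole slice, since such a slice says
  nothing about the other planes. Each such plane spoils only one level, so it suffices to find more
  contradictory levels than spoiling planes. The two windows of levels have about
  \<open>\<delta> / q\<close> and \<open>2 * \<delta> / q\<close> elements against
  \<open>\<delta>\<close> planes, which is where \<open>q \<le> 3\<close> enters. The factor in
  \<open>2 * \<epsilon>\<close> is the one that reproduces itself: the boundary of a rectangle
  consists of two rows and two columns, each with an error of at most \<open>\<epsilon>\<close>, and
  a line in general position uses at most two boundary points; halving \<open>4 * \<epsilon>\<close>
  returns \<open>2 * \<epsilon>\<close>.\<close>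

definition ev :: "nat set \<Rightarrow> (nat \<Rightarrow> real) \<Rightarrow> (nat \<Rightarrow> nat) \<Rightarrow> real" where
  "ev U f x = (\<Sum>i\<in>U. f i * real (x i))"

text \<open>\<open>P\<close> consists of indices, so repeated hyperplanes are counted with
  multiplicity. \<open>U\<close> stays fixed when coordinates are frozen: passing to a slice changes
  only the free coordinates \<open>I\<close>, their sum and the base point \<open>y\<close>.\<close>

definition cov :: "nat set \<Rightarrow> (nat \<Rightarrow> nat \<Rightarrow> real) \<Rightarrow> (nat \<Rightarrow> real) \<Rightarrow> nat set \<Rightarrow> (nat \<Rightarrow> nat) \<Rightarrow> nat" where
  "cov U al ka P x = card {h \<in> P. ev U (al h) x = ka h}"

text \<open>On \<open>simplex I n y\<close>, a form that is constant on \<open>I\<close> takes a single value; such forms are not hyperplanes.\<close>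

definition cst :: "(nat \<Rightarrow> real) \<Rightarrow> nat set \<Rightarrow> bool" where
  "cst f K \<longleftrightarrow> (\<forall>i\<in>K. \<forall>j\<in>K. f i = f j)"

definition simplex :: "nat set \<Rightarrow> nat \<Rightarrow> (nat \<Rightarrow> nat) \<Rightarrow> (nat \<Rightarrow> nat) set" where
  "simplex I n y = {x. (\<forall>i. i \<notin> I \<longrightarrow> x i = y i) \<and> sum x I = n}"

text \<open>Truncated subtraction counts only what is missing, so a surplus at one point of the line
  cannot pay for a shortage at another.\<close>

definition deficit where
  "deficit U al ka P \<kappa> r s x =
     (\<Sum>t\<le>x r + x s. \<kappa> - cov U al ka P (x(r := t, s := x r + x s - t)))"

text \<open>\<open>K\<close> depends on \<open>q\<close>, \<open>\<kappa>\<close> and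
  \<open>D\<close> only. Uniformity in \<open>y\<close> and \<open>\<epsilon>\<close> lets the
  induction use arbitrary slices and a deficit bound that is chosen afterwards.\<close>

definition corner :: "nat \<Rightarrow> nat \<Rightarrow> nat \<Rightarrow> bool" where
  "corner q \<kappa> D \<longleftrightarrow> (\<exists>K. \<forall>U I P al ka y n \<epsilon>.
     finite U \<longrightarrow> I \<subseteq> U \<longrightarrow> card I = D \<longrightarrow> finite P \<longrightarrow> (\<forall>h\<in>P. \<not> cst (al h) I) \<longrightarrow>
     (\<forall>x\<in>simplex I n y. \<forall>r\<in>I. \<forall>s\<in>I. r \<noteq> s \<longrightarrow> deficit U al ka P \<kappa> r s x \<le> \<epsilon>) \<longrightarrow>
     q * n \<le> card P + 2 * \<epsilon> + K)"

section \<open>Linear forms on lines of the simplex\<close>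

lemma cstD: "cst f K \<Longrightarrow> i \<in> K \<Longrightarrow> j \<in> K \<Longrightarrow> f i = f j"
  unfolding cst_def by blast

lemma ev_upd:
  assumes "finite U" "r \<in> U"
  shows "ev U f (x(r := t)) = ev U f x + f r * (real t - real (x r))"
proof -
  have "ev U f (x(r := t)) = f r * real t + (\<Sum>i\<in>U-{r}. f i * real (x i))"
    unfolding ev_def using assms by (subst sum.remove[of _ r]) (auto intro!: sum.cong)
  moreover have "ev U f x = f r * real (x r) + (\<Sum>i\<in>U-{r}. f i * real (x i))"
    unfolding ev_def using assms by (subst sum.remove[of _ r]) auto
  ultimately show ?thesis by (simp add: algebra_simps)
qed

lemma ev_line:
  assumes "finite U" "r \<in> U" "s \<in> U" "r \<noteq> s" "t \<le> m"
  shows "ev U f (x(r := t, s := m - t)) = ev U f (x(r := 0, s := m)) + (f r - f s) * real t"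
  using assms by (simp add: ev_upd of_nat_diff algebra_simps)

lemma ev_const:
  assumes "finite U" "V \<subseteq> U" "cst f V" "\<And>i. i \<notin> V \<Longrightarrow> x i = x' i" "sum x V = sum x' V"
  shows "ev U f x = ev U f x'"
proof -
  have s: "ev U f w = (\<Sum>i\<in>U-V. f i * real (w i)) + (\<Sum>i\<in>V. f i * real (w i))" for w
    unfolding ev_def by (rule sum.subset_diff[OF assms(2,1)])
  have "(\<Sum>i\<in>V. f i * real (x i)) = (\<Sum>i\<in>V. f i * real (x' i))"
  proof (cases "V = {}")
    case False
    then obtain j where j: "j \<in> V" by blast
    have fj: "f i = f j" if "i \<in> V" for i using assms(3) j that unfolding cst_def by blast
    have "(\<Sum>i\<in>V. f i * real (w i)) = f j * real (sum w V)" for w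
      unfolding of_nat_sum sum_distrib_left by (rule sum.cong) (auto dest: fj)
    then show ?thesis using assms(5) by (simp only:)
  qed simp
  moreover have "(\<Sum>i\<in>U-V. f i * real (x i)) = (\<Sum>i\<in>U-V. f i * real (x' i))"
    by (rule sum.cong) (use assms(4) in auto)
  ultimately show ?thesis unfolding s by simp
qed

lemma sum_card_le:
  assumes "finite T" "finite P"
    "\<And>h t t'. h \<in> P \<Longrightarrow> t \<in> T \<Longrightarrow> t' \<in> T \<Longrightarrow> R h t \<Longrightarrow> R h t' \<Longrightarrow> t = t'"
  shows "(\<Sum>t\<in>T. card {h \<in> P. R h t}) \<le> card P"
proof -
  have "card (\<Union>t\<in>T. {h \<in> P. R h t}) = (\<Sum>t\<in>T. card {h \<in> P. R h t})"
  proof (rule card_UN_disjoint)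
    show "\<forall>i\<in>T. \<forall>j\<in>T. i \<noteq> j \<longrightarrow> {h \<in> P. R h i} \<inter> {h \<in> P. R h j} = {}"
      using assms(3) by blast
  qed (use assms in auto)
  moreover have "card (\<Union>t\<in>T. {h \<in> P. R h t}) \<le> card P"
    by (rule card_mono) (use assms in auto)
  ultimately show ?thesis by simp
qed

lemma card_split:
  assumes "finite P"
  shows "card {h \<in> P. R h} = card {h \<in> P. R h \<and> Q h} + card {h \<in> P. R h \<and> \<not> Q h}"
proof -
  have "{h \<in> P. R h} = {h \<in> P. R h \<and> Q h} \<union> {h \<in> P. R h \<and> \<not> Q h}" by auto
  then show ?thesis
    using card_Un_disjoint[of "{h \<in> P. R h \<and> Q h}" "{h \<in> P. R h \<and> \<not> Q h}"] assms by auto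
qed

lemma simplex_line:
  assumes "x \<in> simplex I n y" "finite I" "r \<in> I" "s \<in> I" "r \<noteq> s" "t \<le> x r + x s"
  shows "x(r := t, s := x r + x s - t) \<in> simplex I n y"
proof -
  have "sum w I = w r + w s + sum w (I - {r,s})" for w :: "nat \<Rightarrow> nat"
  proof -
    have "sum w I = w r + sum w (I - {r})" by (rule sum.remove) (use assms in auto)
    also have "sum w (I - {r}) = w s + sum w (I - {r} - {s})" by (rule sum.remove) (use assms in auto)
    also have "I - {r} - {s} = I - {r,s}" by auto
    finally show ?thesis by simp
  qed
  note s = this
  have "sum (x(r := t, s := x r + x s - t)) (I - {r,s}) = sum x (I - {r,s})"
    by (rule sum.cong) auto
  moreover have "sum (x(r := t, s := x r + x s - t)) I
      = x r + x s + sum (x(r := t, s := x r + x s - t)) (I - {r,s})"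
    using assms by (subst s) simp
  ultimately have "sum (x(r := t, s := x r + x s - t)) I = sum x I" using s[of x] by simp
  then show ?thesis using assms unfolding simplex_def by simp
qed

text \<open>With two coordinates the simplex is a single line of \<open>n + 1\<close> points that no
  plane of \<open>P\<close> contains. The planes supply at most \<open>card P\<close> incidences,
  and the deficit accounts for the rest.\<close>

lemma corner_base: "corner q q 2"
  unfolding corner_def
proof (intro exI[of _ 0] allI impI)
  fix U I P :: "nat set" and al :: "nat \<Rightarrow> nat \<Rightarrow> real" and ka y n \<epsilon>
  assume a: "finite U" "I \<subseteq> U" "card I = 2" "finite P" "\<forall>h\<in>P. \<not> cst (al h) I"
    and e: "\<forall>x\<in>simplex I n y. \<forall>r\<in>I. \<forall>s\<in>I. r \<noteq> s \<longrightarrow> deficit U al ka P q r s x \<le> \<epsilon>"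
  obtain r s where I: "I = {r,s}" "r \<noteq> s" using a(3) by (metis card_2_iff)
  have rs: "r \<in> U" "s \<in> U" using I a(2) by auto
  define x where "x = y(r := n, s := 0)"
  have x: "x \<in> simplex I n y" using I by (auto simp: x_def simplex_def)
  have m: "x r + x s = n" using I by (simp add: x_def)
  have *: "(\<Sum>t\<le>n. card {h\<in>P. ev U (al h) (x(r := t, s := n - t)) = ka h}) \<le> card P"
  proof (rule sum_card_le)
    fix h t t' assume h: "h \<in> P" "t \<in> {..n}" "t' \<in> {..n}"
      and e: "ev U (al h) (x(r := t, s := n - t)) = ka h" "ev U (al h) (x(r := t', s := n - t')) = ka h"
    have "al h r \<noteq> al h s" using a(5) h I by (auto simp: cst_def)
    moreover have "(al h r - al h s) * real t = (al h r - al h s) * real t'"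
      using e h ev_line[OF a(1) rs I(2), of t n "al h" x] ev_line[OF a(1) rs I(2), of t' n "al h" x] by simp
    ultimately show "t = t'" by simp
  qed (use a in auto)
  have "q * n \<le> (\<Sum>t\<le>n. q)" by simp
  also have "\<dots> \<le> (\<Sum>t\<le>n. (q - cov U al ka P (x(r := t, s := n - t))) + cov U al ka P (x(r := t, s := n - t)))"
    by (rule sum_mono) simp
  also have "\<dots> = deficit U al ka P q r s x + (\<Sum>t\<le>n. cov U al ka P (x(r := t, s := n - t)))"
    by (simp add: sum.distrib deficit_def m)
  also have "\<dots> \<le> \<epsilon> + card P" using e x I * by (intro add_mono) (auto simp: cov_def)
  finally show "q * n \<le> card P + 2 * \<epsilon> + 0" by simp
qed

section \<open>Lines meeting the boundary of a rectangle\<close>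

lemma card_le_2I:
  assumes "\<And>x y z. x \<in> A \<Longrightarrow> y \<in> A \<Longrightarrow> z \<in> A \<Longrightarrow> x = y \<or> y = z \<or> x = z"
  shows "card A \<le> 2"
proof (rule ccontr)
  assume "\<not> card A \<le> 2"
  then obtain B where "B \<subseteq> A" "card B = 3"
    by (metis not_less_eq_eq numeral_2_eq_2 numeral_3_eq_3 obtain_subset_with_card_n)
  then obtain x y z where "B = {x,y,z}" "x \<noteq> y" "y \<noteq> z" "x \<noteq> z" by (auto simp: card_3_iff)
  then show False using assms[of x y z] \<open>B \<subseteq> A\<close> by blast
qed

text \<open>With both coefficients nonzero, both coordinates are strictly monotone along the line.
  The middle one of three points would therefore lie strictly inside the rectangle.\<close>

lemma frame_line:
  fixes f g k :: real and z1 z2 t1 t2 :: nat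
  assumes fg: "f \<noteq> 0" "g \<noteq> 0"
    and A: "\<And>z t. (z,t) \<in> A \<Longrightarrow> f * real z + g * real t = k \<and> z1 \<le> z \<and> z \<le> z2 \<and> t1 \<le> t \<and> t \<le> t2 \<and>
                      (z = z1 \<or> z = z2 \<or> t = t1 \<or> t = t2)"
  shows "card A \<le> 2"
proof (rule card_le_2I)
  fix a b c assume abc: "a \<in> A" "b \<in> A" "c \<in> A"
  have no: False if "(z,t) \<in> A" "(z',t') \<in> A" "(z'',t'') \<in> A" "z < z'" "z' < z''" for z t z' t' z'' t''
  proof -
    have e: "f * (real z' - real z) = - g * (real t' - real t)" "f * (real z'' - real z') = - g * (real t'' - real t')"
      using A[OF that(1)] A[OF that(2)] A[OF that(3)] by (simp_all add: algebra_simps)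
    have m: "z' \<noteq> z1" "z' \<noteq> z2" using A[OF that(1)] A[OF that(3)] that by auto
    have "t' = t1 \<or> t' = t2" using A[OF that(2)] m by auto
    define u where "u = - f / g"
    have u: "real t' - real t = u * (real z' - real z)" "real t'' - real t' = u * (real z'' - real z')"
      using e fg by (simp_all add: u_def field_simps)
    have "u \<noteq> 0" using fg by (simp add: u_def)
    then consider "u > 0" | "u < 0" by linarith
    then show False
    proof cases
      case 1
      then have "real t' - real t > 0" "real t'' - real t' > 0" using u that by simp_all
      then show False using A[OF that(1)] A[OF that(3)] \<open>t' = t1 \<or> t' = t2\<close> by auto
    next
      case 2
      then have "real t' - real t < 0" "real t'' - real t' < 0" using u that by (simp_all add: mult_less_0_iff)
      then show False using A[OF that(1)] A[OF that(3)] \<open>t' = t1 \<or> t' = t2\<close> by auto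
    qed
  qed
  have inj: "a = b" if "a \<in> A" "b \<in> A" "fst a = fst b" for a b
  proof -
    have "f * real (fst a) + g * real (snd a) = k" "f * real (fst b) + g * real (snd b) = k"
      using A[of "fst a" "snd a"] A[of "fst b" "snd b"] that(1,2) by simp_all
    moreover have "f * real (fst a) = f * real (fst b)" using that(3) by simp
    ultimately have "g * real (snd a) = g * real (snd b)" by linarith
    then show ?thesis using fg that(3) by (simp add: prod_eq_iff)
  qed
  show "a = b \<or> b = c \<or> a = c"
  proof (rule ccontr)
    assume n: "\<not> ?thesis"
    then have "fst a \<noteq> fst b" "fst b \<noteq> fst c" "fst a \<noteq> fst c" using inj abc by blast+
    moreover have no': False if "a \<in> A" "b \<in> A" "c \<in> A" "fst a < fst b" "fst b < fst c" for a b c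
      using no[of "fst a" "snd a" "fst b" "snd b" "fst c" "snd c"] that by simp
    ultimately show False
      using no'[OF abc(1,2,3)] no'[OF abc(1,3,2)] no'[OF abc(2,1,3)] no'[OF abc(2,3,1)]
        no'[OF abc(3,1,2)] no'[OF abc(3,2,1)] by linarith
  qed
qed

lemma frame_sum:
  fixes f g k :: "nat \<Rightarrow> real"
  assumes fin: "finite G" "finite B" and fg: "\<And>h. h \<in> G \<Longrightarrow> f h \<noteq> 0 \<and> g h \<noteq> 0"
    and B: "\<And>z t. (z,t) \<in> B \<Longrightarrow> z1 \<le> z \<and> z \<le> z2 \<and> t1 \<le> t \<and> t \<le> t2 \<and> (z = z1 \<or> z = z2 \<or> t = t1 \<or> t = t2)"
  shows "(\<Sum>(z,t)\<in>B. card {h\<in>G. f h * real z + g h * real t = k h}) \<le> 2 * card G"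
proof -
  have "(\<Sum>b\<in>B. card {h\<in>G. f h * real (fst b) + g h * real (snd b) = k h})
      = (\<Sum>h\<in>G. card {b\<in>B. f h * real (fst b) + g h * real (snd b) = k h})"
    by (rule sum_multicount_gen) (use fin in \<open>auto intro!: sum.cong\<close>)
  also have "\<dots> \<le> (\<Sum>h\<in>G. 2)"
  proof (rule sum_mono)
    fix h assume "h \<in> G"
    then show "card {b\<in>B. f h * real (fst b) + g h * real (snd b) = k h} \<le> 2"
      using fg[of h] by (intro frame_line[of "f h" "g h" _ "k h" z1 z2 t1 t2]) (auto dest: B)
  qed
  finally show ?thesis by (simp add: case_prod_unfold)
qed

section \<open>Splitting off a pair of coordinates\<close>

locale split_pair =
  fixes U I P :: "nat set" and al :: "nat \<Rightarrow> nat \<Rightarrow> real" and ka :: "nat \<Rightarrow> real"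
    and y :: "nat \<Rightarrow> nat" and n \<epsilon> q \<kappa> p p' :: nat
  assumes fU: "finite U" and IU: "I \<subseteq> U" and fP: "finite P"
    and nonconst: "\<And>h. h \<in> P \<Longrightarrow> \<not> cst (al h) I"
    and edges: "\<And>x r s. x \<in> simplex I n y \<Longrightarrow> r \<in> I \<Longrightarrow> s \<in> I \<Longrightarrow> r \<noteq> s \<Longrightarrow>
                  deficit U al ka P (\<kappa> + q - 1) r s x \<le> \<epsilon>"
    and p: "p \<in> I" "p' \<in> I" "p \<noteq> p'" and q1: "q \<ge> 1"
begin

definition "V = I - {p, p'}"
text \<open>On a slice \<open>x p + x p' = c\<close>, forms of \<open>DD\<close> are constant, those
  of \<open>AA\<close> vary only along the segment of the pair, those of \<open>BB\<close> only
  along the smaller simplex, and those of \<open>GG\<close> along both. Hence a plane of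
  \<open>DD\<close> that meets a slice contains it.\<close>

definition "DD = {h \<in> P. al h p = al h p' \<and> cst (al h) V}"
definition "AA = {h \<in> P. al h p \<noteq> al h p' \<and> cst (al h) V}"
definition "BB = {h \<in> P. al h p = al h p' \<and> \<not> cst (al h) V}"
definition "GG = {h \<in> P. al h p \<noteq> al h p' \<and> \<not> cst (al h) V}"
definition "blocked = {c. c \<le> n \<and> (\<exists>h\<in>DD. \<exists>x\<in>simplex I n y. x p + x p' = c \<and> ev U (al h) x = ka h)}"

lemma fI: "finite I" using fU IU finite_subset by blast
lemma VI: "V \<subseteq> I" "V \<subseteq> U" "p \<notin> V" "p' \<notin> V" "finite V"
  using IU fI by (auto simp: V_def)
lemma I_eq: "insert p (insert p' V) = I" using p by (auto simp: V_def)
lemma I_mem: "i \<in> I \<longleftrightarrow> i = p \<or> i = p' \<or> i \<in> V" using p by (auto simp: V_def)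
lemma sum_I': "sum f I = f p + (f p' + sum f V)"
proof -
  have "sum f (insert p (insert p' V)) = f p + (f p' + sum f V)" using p VI by simp
  then show ?thesis by (simp only: I_eq)
qed
lemma pU: "p \<in> U" "p' \<in> U" using p IU by auto

lemma fin: "finite AA" "finite BB" "finite GG" "finite DD"
  using fP by (simp_all add: AA_def BB_def GG_def DD_def)

lemma card_classes:
  "card {h\<in>P. R h} = card {h\<in>AA. R h} + card {h\<in>BB. R h} + card {h\<in>GG. R h} + card {h\<in>DD. R h}"
proof -
  have "card {h\<in>P. R h} = card {h\<in>P. R h \<and> al h p = al h p'} + card {h\<in>P. R h \<and> al h p \<noteq> al h p'}"
    by (rule card_split[OF fP])
  also have "card {h\<in>P. R h \<and> al h p = al h p'} = card {h\<in>DD. R h} + card {h\<in>BB. R h}"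
    by (subst card_split[OF fP, of _ "\<lambda>h. cst (al h) V"]) (simp add: DD_def BB_def conj_ac)
  also have "card {h\<in>P. R h \<and> al h p \<noteq> al h p'} = card {h\<in>AA. R h} + card {h\<in>GG. R h}"
    by (subst card_split[OF fP, of _ "\<lambda>h. cst (al h) V"]) (simp add: AA_def GG_def conj_ac)
  finally show ?thesis by simp
qed

lemma card_P: "card P = card AA + card BB + card GG + card DD"
  using card_classes[of "\<lambda>_. True"] by simp

lemma sum_I: "sum w I = w p + w p' + sum w V" for w :: "nat \<Rightarrow> nat"
  by (simp add: sum_I')

lemma slice_in:
  assumes "z \<le> c" "c \<le> n" "x \<in> simplex V (n - c) (y(p := z, p' := c - z))"
  shows "x \<in> simplex I n y" "x p = z" "x p' = c - z"
proof -
  show "x p = z" "x p' = c - z" using assms VI p by (auto simp: simplex_def)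
  moreover have "x i = y i" if "i \<notin> I" for i
    using assms that p VI by (auto simp: simplex_def)
  ultimately show "x \<in> simplex I n y" using assms by (simp add: simplex_def sum_I)
qed

lemma cov_split:
  "cov U al ka P x = cov U al ka AA x + cov U al ka BB x + cov U al ka GG x + cov U al ka DD x"
  unfolding cov_def by (rule card_classes)

lemma cov_DD:
  assumes "x \<in> simplex I n y" "x p + x p' \<notin> blocked"
  shows "cov U al ka DD x = 0"
proof -
  have "x p + x p' \<le> n" using assms by (simp add: simplex_def sum_I)
  then have "{h\<in>DD. ev U (al h) x = ka h} = {}" using assms by (auto simp: blocked_def)
  then show ?thesis unfolding cov_def by (simp only: card.empty)
qed

text \<open>On the simplex a form of \<open>DD\<close> is an affine function of the level
  \<open>x p + x p'\<close>. Its slope is nonzero, as otherwise the form would be constant on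
  \<open>I\<close>; if \<open>V\<close> is empty, only the level \<open>n\<close> occurs. So each
  plane determines its level.\<close>

lemma card_blocked: "card blocked \<le> card DD"
proof -
  have key: "c = c'" if h: "h \<in> DD" and x: "x \<in> simplex I n y" "x p + x p' = c" "ev U (al h) x = ka h"
    and x': "x' \<in> simplex I n y" "x' p + x' p' = c'" "ev U (al h) x' = ka h" for h x x' c c'
  proof (cases "V = {}")
    case True
    then show ?thesis using x x' by (simp add: simplex_def sum_I)
  next
    case False
    then obtain j where j: "j \<in> V" by blast
    have cV: "cst (al h) V" and pp: "al h p = al h p'" using h by (auto simp: DD_def)
    have ne: "al h p \<noteq> al h j"
    proof
      assume "al h p = al h j"
      then have "al h i = al h p" if "i \<in> I" for i
        using that pp cstD[OF cV _ j, of i] \<open>al h p = al h j\<close> by (auto simp: I_mem)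
      then have "cst (al h) I" unfolding cst_def by metis
      then show False using nonconst h by (auto simp: DD_def)
    qed
    have e: "ev U (al h) w = (\<Sum>i\<in>U-I. al h i * real (w i)) + al h p * real (w p + w p') + al h j * real (sum w V)" for w
    proof -
      have "ev U (al h) w = (\<Sum>i\<in>U-I. al h i * real (w i)) + (\<Sum>i\<in>I. al h i * real (w i))"
        unfolding ev_def by (rule sum.subset_diff[OF IU fU])
      also have "(\<Sum>i\<in>I. al h i * real (w i)) = al h p * real (w p) + al h p' * real (w p') + (\<Sum>i\<in>V. al h i * real (w i))"
        by (simp add: sum_I')
      also have "(\<Sum>i\<in>V. al h i * real (w i)) = (\<Sum>i\<in>V. al h j * real (w i))"
      proof (rule sum.cong)
        fix i assume "i \<in> V"
        then have "al h i = al h j" using cV j unfolding cst_def by blast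
        then show "al h i * real (w i) = al h j * real (w i)" by simp
      qed simp
      also have "\<dots> = al h j * real (sum w V)" by (simp add: sum_distrib_left)
      finally show ?thesis by (simp add: pp algebra_simps)
    qed
    have out: "(\<Sum>i\<in>U-I. al h i * real (x i)) = (\<Sum>i\<in>U-I. al h i * real (x' i))"
      by (rule sum.cong) (use x x' in \<open>auto simp: simplex_def\<close>)
    have "sum x V = n - c" "c \<le> n" "sum x' V = n - c'" "c' \<le> n"
      using x x' by (auto simp: simplex_def sum_I)
    then have sV: "real (sum x V) = real n - real c" "real (sum x' V) = real n - real c'"
      by (simp_all only: of_nat_diff)
    have "al h p * real c + al h j * (real n - real c) = al h p * real c' + al h j * (real n - real c')"
      using e[of x] e[of x'] out x x' sV by simp
    then have "(al h p - al h j) * (real c - real c') = 0" by (simp add: algebra_simps)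
    then show ?thesis using ne by simp
  qed
  have "\<forall>c\<in>blocked. \<exists>h\<in>DD. \<exists>x\<in>simplex I n y. x p + x p' = c \<and> ev U (al h) x = ka h"
    by (auto simp: blocked_def)
  then obtain H where H: "\<And>c. c \<in> blocked \<Longrightarrow> H c \<in> DD \<and> (\<exists>x\<in>simplex I n y. x p + x p' = c \<and> ev U (al (H c)) x = ka (H c))"
    by metis
  have "inj_on H blocked"
  proof (rule inj_onI)
    fix c c' assume "c \<in> blocked" "c' \<in> blocked" "H c = H c'"
    then show "c = c'" using H[of c] H[of c'] key by metis
  qed
  moreover have "H ` blocked \<subseteq> DD" using H by blast
  ultimately show ?thesis using fin card_inj_on_le by blast
qed

lemma slab_nonconst: "h \<in> BB \<union> GG \<Longrightarrow> \<not> cst (al h) V"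
  by (auto simp: BB_def GG_def)

text \<open>A plane of \<open>AA\<close> meets the slice \<open>x p + x p' = c\<close> in at most one value of \<open>x p\<close>, so some value is
  met by fewer than \<open>q\<close> of them; there the other planes form a cover of the remaining simplex.\<close>

lemma slab_bound:
  assumes IH: "\<And>P' y'. finite P' \<Longrightarrow> (\<forall>h\<in>P'. \<not> cst (al h) V) \<Longrightarrow>
      (\<forall>x\<in>simplex V (n - c) y'. \<forall>r\<in>V. \<forall>s\<in>V. r \<noteq> s \<longrightarrow> deficit U al ka P' \<kappa> r s x \<le> \<epsilon>) \<Longrightarrow>
      q * (n - c) \<le> card P' + 2 * \<epsilon> + K"
    and c: "c \<le> n" "c \<notin> blocked" "q * (c + 1) > card AA"
  shows "card AA + card DD + q * (n - c) \<le> card P + 2 * \<epsilon> + K"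
proof (cases "V = {}")
  case True
  have "q * (n - c) \<le> card (BB \<union> GG) + 2 * \<epsilon> + K"
    by (rule IH) (use fin slab_nonconst True in auto)
  then show ?thesis using card_P card_Un_le[of BB GG] by linarith
next
  case False
  then obtain j where j: "j \<in> V" by blast
  \<comment> \<open>One representative for each value of \<open>x p\<close>. Forms of
    \<open>AA\<close> are constant on \<open>V\<close>, so they do not see how the remaining sum
    \<open>n - c\<close> is distributed, and all of it is put on \<open>j\<close>.\<close>
  define w where "w z = (\<lambda>i. if i \<in> V then (if i = j then n - c else 0) else if i = p then z else if i = p' then c - z else y i)" for z
  have w: "w z \<in> simplex V (n - c) (y(p := z, p' := c - z))" for z
    using VI j p by (auto simp: w_def simplex_def)
  have w_line: "w z = (w 0)(p := z, p' := c - z)" for z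
    using VI p by (auto simp: w_def)
  have hit1: "(\<Sum>z\<le>c. cov U al ka AA (w z)) \<le> card AA" unfolding cov_def
  proof (rule sum_card_le)
    fix h t t' assume h: "h \<in> AA" "t \<in> {..c}" "t' \<in> {..c}"
      and e: "ev U (al h) (w t) = ka h" "ev U (al h) (w t') = ka h"
    have "ev U (al h) (w z) = ev U (al h) ((w 0)(p := 0, p' := c)) + (al h p - al h p') * real z" if "z \<le> c" for z
      using ev_line[OF fU pU p(3) that, of "al h" "w 0"] w_line[of z] by simp
    note this[of t] this[of t']
    moreover have "t \<le> c" "t' \<le> c" using h by auto
    ultimately have "(al h p - al h p') * real t = (al h p - al h p') * real t'" using e by linarith
    then show "t = t'" using h by (simp add: AA_def)
  qed (use fin in auto)
  have "\<exists>z\<le>c. cov U al ka AA (w z) < q"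
  proof (rule ccontr)
    assume "\<not> ?thesis"
    then have "(\<Sum>z\<le>c. q) \<le> (\<Sum>z\<le>c. cov U al ka AA (w z))" by (intro sum_mono) (auto simp: not_less)
    moreover have "(\<Sum>z\<le>c. q) = q * (c + 1)" by simp
    ultimately show False using hit1 c(3) by linarith
  qed
  then obtain z where z: "z \<le> c" "cov U al ka AA (w z) < q" by blast
  let ?y = "y(p := z, p' := c - z)"
  have "q * (n - c) \<le> card (BB \<union> GG) + 2 * \<epsilon> + K"
  proof (rule IH)
    show "\<forall>x\<in>simplex V (n - c) ?y. \<forall>r\<in>V. \<forall>s\<in>V. r \<noteq> s \<longrightarrow> deficit U al ka (BB \<union> GG) \<kappa> r s x \<le> \<epsilon>"
    proof (intro ballI impI)
      fix x r s assume x: "x \<in> simplex V (n - c) ?y" and rs: "r \<in> V" "s \<in> V" "r \<noteq> s"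
      have xI: "x \<in> simplex I n y" using slice_in(1)[OF z(1) c(1) x] .
      have "deficit U al ka (BB \<union> GG) \<kappa> r s x \<le> deficit U al ka P (\<kappa> + q - 1) r s x"
        unfolding deficit_def
      proof (rule sum_mono)
        fix t assume t: "t \<in> {..x r + x s}"
        let ?x = "x(r := t, s := x r + x s - t)"
        have x': "?x \<in> simplex V (n - c) ?y" using simplex_line[OF x VI(5) rs] t by simp
        have "cov U al ka DD ?x = 0"
          using cov_DD[OF slice_in(1)[OF z(1) c(1) x']] slice_in(2,3)[OF z(1) c(1) x'] c(2) z(1) by simp
        moreover have "cov U al ka AA ?x = cov U al ka AA (w z)"
        proof -
          have "ev U (al h) ?x = ev U (al h) (w z)" if "h \<in> AA" for h
          proof (rule ev_const[OF fU VI(2)])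
            show "cst (al h) V" using that by (simp add: AA_def)
            show "?x i = w z i" if "i \<notin> V" for i using x' w[of z] that by (simp add: simplex_def)
            show "sum ?x V = sum (w z) V" using x' w[of z] by (simp add: simplex_def)
          qed
          then show ?thesis unfolding cov_def by (metis (mono_tags, lifting))
        qed
        moreover have "cov U al ka (BB \<union> GG) ?x = cov U al ka BB ?x + cov U al ka GG ?x"
        proof -
          have "{h \<in> BB \<union> GG. ev U (al h) ?x = ka h} = {h\<in>BB. ev U (al h) ?x = ka h} \<union> {h\<in>GG. ev U (al h) ?x = ka h}" by auto
          moreover have "{h\<in>BB. ev U (al h) ?x = ka h} \<inter> {h\<in>GG. ev U (al h) ?x = ka h} = {}"
            by (auto simp: BB_def GG_def)
          ultimately show ?thesis unfolding cov_def using fin by (simp only:) (rule card_Un_disjoint; simp)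
        qed
        \<comment> \<open>At most \<open>q - 1\<close> planes of \<open>AA\<close> and none of
          \<open>DD\<close> pass through the point, so a demand of \<open>\<kappa>\<close> is left
          to the other two classes.\<close>
        ultimately show "\<kappa> - cov U al ka (BB \<union> GG) ?x \<le> \<kappa> + q - 1 - cov U al ka P ?x"
          using z(2) cov_split[of ?x] by linarith
      qed
      also have "\<dots> \<le> \<epsilon>" using edges[OF xI] rs VI by blast
      finally show "deficit U al ka (BB \<union> GG) \<kappa> r s x \<le> \<epsilon>" .
    qed
  qed (use fin slab_nonconst in auto)
  then show ?thesis using card_P card_Un_le[of BB GG] by linarith
qed

text \<open>In the rectangle with \<open>x p\<close> and \<open>x r\<close> as coordinates, a plane of \<open>GG\<close> with \<open>al h r \<noteq> al h s\<close> is a line that is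
  not parallel to a side, so it covers at most two points of the boundary.\<close>

lemma edge_bound:
  assumes c: "c \<le> n" "c \<notin> blocked" and rs: "r \<in> V" "s \<in> V" "r \<noteq> s"
    and x: "x \<in> simplex V (n - c) (y(p := c, p' := 0))"
    and pos: "deficit U al ka BB \<kappa> r s x \<ge> 1"
  shows "q * c \<le> card AA + card {h\<in>GG. al h r = al h s} \<or>
         q * c + deficit U al ka BB \<kappa> r s x \<le> card AA + card GG + 2 * \<epsilon> + 2 * \<kappa>"
proof -
  define m where "m = x r + x s"
  define X where "X z t = x(p := z, p' := c - z, r := t, s := m - t)" for z t
  define F where "F = {h\<in>GG. al h r = al h s}"
  define G where "G = {h\<in>GG. al h r \<noteq> al h s}"
  have dist: "p \<noteq> r" "p \<noteq> s" "p' \<noteq> r" "p' \<noteq> s" using rs VI by auto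
  have rsU: "r \<in> U" "s \<in> U" "r \<in> I" "s \<in> I" using rs VI by auto
  have finFG: "finite F" "finite G" using fin by (auto simp: F_def G_def)
  have card_GG: "card GG = card F + card G"
    using card_split[OF fin(3), of "\<lambda>_. True" "\<lambda>h. al h r = al h s"] by (simp add: F_def G_def)
  have cov_GG: "cov U al ka GG w = cov U al ka F w + cov U al ka G w" for w
    using card_split[OF fin(3), of "\<lambda>h. ev U (al h) w = ka h" "\<lambda>h. al h r = al h s"]
    by (simp add: cov_def F_def G_def conj_ac)
  have xp: "x p = c" "x p' = 0" using x VI p by (auto simp: simplex_def)
  have XI: "X z t \<in> simplex I n y" if "z \<le> c" "t \<le> m" for z t
  proof -
    have x1: "x \<in> simplex I n y" using slice_in(1)[of c c x] x c by simp
    have "x(p := z, p' := x p + x p' - z) \<in> simplex I n y"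
      by (rule simplex_line[OF x1 fI p]) (use xp that in simp)
    then have x2: "x(p := z, p' := c - z) \<in> simplex I n y" using xp by simp
    show ?thesis using simplex_line[OF x2 fI rsU(3,4) rs(3), of t] that dist
      by (simp add: X_def m_def)
  qed
  have Xpp: "X z t p = z" "X z t p' = c - z" "X z t r = t" "X z t s = m - t" for z t
    using dist rs p by (auto simp: X_def)
  have Xz: "X z t = (X z' t)(p := z, p' := c - z)" for z z' t
    using dist p rs by (auto simp: X_def)
  have Xt: "X z t = (X z t')(r := t, s := m - t)" for z t t'
    using dist p rs by (auto simp: X_def)
  have evz: "ev U (al h) (X z t) = ev U (al h) (X 0 t) + (al h p - al h p') * real z" if "z \<le> c" for h z t
    using ev_line[OF fU pU p(3) that, of "al h" "X 0 t"] Xz[of z t 0] Xz[of 0 t 0] by simp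
  have evt: "ev U (al h) (X z t) = ev U (al h) (X z 0) + (al h r - al h s) * real t" if "t \<le> m" for h z t
    using ev_line[OF fU rsU(1,2) rs(3) that, of "al h" "X z 0"] Xt[of z t 0] Xt[of z 0 0] by simp
  have covA: "cov U al ka AA (X z t) = cov U al ka AA (X z 0)" if "t \<le> m" for z t
  proof -
    have "ev U (al h) (X z t) = ev U (al h) (X z 0)" if "h \<in> AA" for h
    proof -
      have "al h r = al h s" using that cstD[OF _ rs(1,2)] by (simp add: AA_def)
      then show ?thesis using evt[OF \<open>t \<le> m\<close>, of h z] by simp
    qed
    then show ?thesis unfolding cov_def by (metis (mono_tags, lifting))
  qed
  have covF: "cov U al ka F (X z t) = cov U al ka F (X z 0)" if "t \<le> m" for z t
  proof -
    have "ev U (al h) (X z t) = ev U (al h) (X z 0)" if "h \<in> F" for h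
      using evt[OF \<open>t \<le> m\<close>, of h z] that by (simp add: F_def)
    then show ?thesis unfolding cov_def by (metis (mono_tags, lifting))
  qed
  have covB: "cov U al ka BB (X z t) = cov U al ka BB (x(r := t, s := m - t))" if "z \<le> c" for z t
  proof -
    have "x(r := t, s := m - t) = X c t" using xp dist by (auto simp: X_def)
    moreover have "ev U (al h) (X z t) = ev U (al h) (X c t)" if "h \<in> BB" for h
      using evz[OF \<open>z \<le> c\<close>, of h t] evz[of c h t] that by (simp add: BB_def)
    ultimately show ?thesis unfolding cov_def by (metis (mono_tags, lifting))
  qed
  \<comment> \<open>Unmet demands: \<open>a\<close> after the planes that depend only on
    \<open>z\<close>, and \<open>b\<close> after those that depend only on \<open>t\<close>. Only
    the planes of \<open>G\<close> can meet what remains.\<close>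
  define a where "a z = q - (cov U al ka AA (X z 0) + cov U al ka F (X z 0))" for z
  define b where "b t = \<kappa> - cov U al ka BB (x(r := t, s := m - t))" for t
  define g where "g z t = cov U al ka G (X z t)" for z t
  define Zs where "Zs = {z. z \<le> c \<and> a z \<ge> 1}"
  define Es where "Es = {t. t \<le> m \<and> b t \<ge> 1}"
  have fins: "finite Zs" "finite Es" by (auto simp: Zs_def Es_def)
  have sb: "deficit U al ka BB \<kappa> r s x = sum b Es"
  proof -
    have "sum b {..m} = sum b Es" by (rule sum.mono_neutral_right) (auto simp: Es_def)
    then show ?thesis by (simp add: deficit_def b_def m_def)
  qed
  have sa: "q * (c + 1) \<le> sum a Zs + card AA + card F"
  proof -
    have *: "(\<Sum>z\<le>c. cov U al ka S (X z 0)) \<le> card S" if S: "finite S" "\<And>h. h \<in> S \<Longrightarrow> al h p \<noteq> al h p'" for S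
      unfolding cov_def
    proof (rule sum_card_le)
      fix h t t' assume h: "h \<in> S" "t \<in> {..c}" "t' \<in> {..c}"
        and e: "ev U (al h) (X t 0) = ka h" "ev U (al h) (X t' 0) = ka h"
      have "(al h p - al h p') * real t = (al h p - al h p') * real t'"
      proof -
        have "t \<le> c" "t' \<le> c" using h by auto
        then show ?thesis using evz[of t h 0] evz[of t' h 0] e by linarith
      qed
      then show "t = t'" using S(2)[OF h(1)] by simp
    qed (use S in auto)
    have "q * (c + 1) = (\<Sum>z\<le>c. q)" by simp
    also have "\<dots> \<le> (\<Sum>z\<le>c. a z + cov U al ka AA (X z 0) + cov U al ka F (X z 0))"
      by (rule sum_mono) (simp add: a_def)
    also have "\<dots> \<le> sum a {..c} + card AA + card F"
      using *[OF fin(1)] *[OF finFG(1)] by (simp add: sum.distrib AA_def F_def GG_def)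
    also have "sum a {..c} = sum a Zs" by (rule sum.mono_neutral_right) (auto simp: Zs_def)
    finally show ?thesis .
  qed
  have key: "a z + b t \<le> (\<kappa> + q - 1 - cov U al ka P (X z t)) + 1 + g z t" if "z \<in> Zs" "t \<in> Es" for z t
  proof -
    have zt: "z \<le> c" "t \<le> m" "a z \<ge> 1" "b t \<ge> 1" using that by (auto simp: Zs_def Es_def)
    have "cov U al ka DD (X z t) = 0"
      using cov_DD[OF XI[OF zt(1,2)]] Xpp[of z t] zt c by simp
    then have "cov U al ka P (X z t) = cov U al ka AA (X z 0) + cov U al ka BB (x(r := t, s := m - t))
        + cov U al ka F (X z 0) + g z t"
      using cov_split[of "X z t"] cov_GG[of "X z t"] covA[OF zt(2), of z] covF[OF zt(2), of z] covB[OF zt(1), of t]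
      by (simp add: g_def)
    then show ?thesis using zt(3,4) unfolding a_def b_def by linarith
  qed
  have row: "sum a Z \<le> \<epsilon> + (\<Sum>z\<in>Z. g z t)" if "t \<in> Es" "Z \<subseteq> Zs" for t Z
  proof -
    have t: "t \<le> m" "b t \<ge> 1" using that by (auto simp: Es_def)
    have "sum a Z \<le> (\<Sum>z\<in>Z. (\<kappa> + q - 1 - cov U al ka P (X z t)) + g z t)"
      by (rule sum_mono) (use key[of _ t] that t in fastforce)
    also have "\<dots> = (\<Sum>z\<in>Z. \<kappa> + q - 1 - cov U al ka P (X z t)) + (\<Sum>z\<in>Z. g z t)" by (rule sum.distrib)
    also have "(\<Sum>z\<in>Z. \<kappa> + q - 1 - cov U al ka P (X z t)) \<le> (\<Sum>z\<le>c. \<kappa> + q - 1 - cov U al ka P (X z t))"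
      by (rule sum_mono2) (use that in \<open>auto simp: Zs_def\<close>)
    also have "\<dots> = deficit U al ka P (\<kappa> + q - 1) p p' (X 0 t)"
      by (simp add: deficit_def Xpp Xz[of _ t 0, symmetric])
    also have "\<dots> \<le> \<epsilon>" by (rule edges[OF XI p]) (use t in auto)
    finally show ?thesis by simp
  qed
  have col: "sum b T \<le> \<epsilon> + (\<Sum>t\<in>T. g z t)" if "z \<in> Zs" "T \<subseteq> Es" for z T
  proof -
    have z: "z \<le> c" "a z \<ge> 1" using that by (auto simp: Zs_def)
    have "sum b T \<le> (\<Sum>t\<in>T. (\<kappa> + q - 1 - cov U al ka P (X z t)) + g z t)"
      by (rule sum_mono) (use key[of z] that z in fastforce)
    also have "\<dots> = (\<Sum>t\<in>T. \<kappa> + q - 1 - cov U al ka P (X z t)) + (\<Sum>t\<in>T. g z t)" by (rule sum.distrib)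
    also have "(\<Sum>t\<in>T. \<kappa> + q - 1 - cov U al ka P (X z t)) \<le> (\<Sum>t\<le>m. \<kappa> + q - 1 - cov U al ka P (X z t))"
      by (rule sum_mono2) (use that in \<open>auto simp: Es_def\<close>)
    also have "\<dots> = deficit U al ka P (\<kappa> + q - 1) r s (X z 0)"
      by (simp add: deficit_def Xpp Xt[of z _ 0, symmetric])
    also have "\<dots> \<le> \<epsilon>" by (rule edges[OF XI rsU(3,4) rs(3)]) (use z in auto)
    finally show ?thesis by simp
  qed
  have aq: "a z \<le> q" and bk: "b t \<le> \<kappa>" for z t by (auto simp: a_def b_def)
  have Ene: "Es \<noteq> {}" using pos sb by auto
  show ?thesis
  proof (cases "card Zs \<le> 1")
    \<comment> \<open>A single \<open>z\<close> with unmet demand accounts for at most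
      \<open>q\<close>, the difference between \<open>q * (c + 1)\<close> and
      \<open>q * c\<close>.\<close>
    case True
    have "sum a Zs \<le> card Zs * q" using sum_bounded_above[of Zs a q] aq by simp
    also have "\<dots> \<le> 1 * q" by (rule mult_right_mono) (use True in auto)
    finally have "q * c \<le> card AA + card F" using sa by simp
    then show ?thesis by (simp add: F_def)
  next
    case Z2: False
    have "sum a Zs + sum b Es \<le> card G + 2 * \<epsilon> + 2 * \<kappa>"
    proof (cases "card Es \<le> 1")
      case True
      obtain t where t: "t \<in> Es" using Ene by blast
      then have "t \<le> m" by (simp add: Es_def)
      have "sum b Es \<le> card Es * \<kappa>" using sum_bounded_above[of Es b \<kappa>] bk by simp
      also have "\<dots> \<le> 1 * \<kappa>" by (rule mult_right_mono) (use True in auto)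
      finally have 1: "sum b Es \<le> \<kappa>" by simp
      have "(\<Sum>z\<in>Zs. g z t) \<le> card G" unfolding g_def cov_def
      proof (rule sum_card_le)
        fix h z z' assume h: "h \<in> G" "z \<in> Zs" "z' \<in> Zs"
          and e: "ev U (al h) (X z t) = ka h" "ev U (al h) (X z' t) = ka h"
        have "(al h p - al h p') * real z = (al h p - al h p') * real z'"
        proof -
          have "z \<le> c" "z' \<le> c" using h by (auto simp: Zs_def)
          then show ?thesis using evz[of z h t] evz[of z' h t] e by linarith
        qed
        then show "z = z'" using h(1) by (simp add: G_def GG_def)
      qed (use finFG fins in auto)
      then show ?thesis using row[OF t subset_refl] 1 by simp
    next
      case E2: False
      define z1 z2 t1 t2 where "z1 = Min Zs" "z2 = Max Zs" "t1 = Min Es" "t2 = Max Es"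
      have ne: "Zs \<noteq> {}" "Es \<noteq> {}" using Z2 E2 by auto
      have in1: "z1 \<in> Zs" "z2 \<in> Zs" "t1 \<in> Es" "t2 \<in> Es"
        using ne fins by (auto simp: z1_z2_t1_t2_def)
      have bd: "z1 \<le> z \<and> z \<le> z2" if "z \<in> Zs" for z using that fins by (simp add: z1_z2_t1_t2_def)
      have bd': "t1 \<le> t \<and> t \<le> t2" if "t \<in> Es" for t using that fins by (simp add: z1_z2_t1_t2_def)
      have z12: "z1 \<noteq> z2"
      proof
        assume "z1 = z2"
        then have "Zs \<subseteq> {z1}" using bd by force
        then show False using Z2 card_mono[of "{z1}" Zs] by simp
      qed
      have t12: "t1 \<noteq> t2"
      proof
        assume "t1 = t2"
        then have "Es \<subseteq> {t1}" using bd' by force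
        then show False using E2 card_mono[of "{t1}" Es] by simp
      qed
      \<comment> \<open>The two rows are taken whole and the two columns without the corners, so
        that no boundary point is counted twice. What the columns lose at \<open>t1\<close> and
        \<open>t2\<close> is at most \<open>2 * \<kappa>\<close>.\<close>
      define E0 where "E0 = Es - {t1, t2}"
      define Bd where "Bd = Zs \<times> {t1,t2} \<union> {z1,z2} \<times> E0"
      define k where "k h = ka h - ev U (al h) (X 0 0)" for h
      have line: "g z t = card {h\<in>G. (al h p - al h p') * real z + (al h r - al h s) * real t = k h}"
        if "z \<le> c" "t \<le> m" for z t
      proof -
        have "ev U (al h) (X z t) = ka h \<longleftrightarrow>
            (al h p - al h p') * real z + (al h r - al h s) * real t = k h" for h
          using evz[OF that(1), of h 0] evt[OF that(2), of h z] unfolding k_def by linarith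
        then show ?thesis by (simp only: g_def cov_def)
      qed
      have "(\<Sum>(z,t)\<in>Bd. g z t) = (\<Sum>(z,t)\<in>Bd. card {h\<in>G. (al h p - al h p') * real z + (al h r - al h s) * real t = k h})"
        by (rule sum.cong) (use in1 in \<open>auto simp: Bd_def E0_def Zs_def Es_def intro!: line\<close>)
      also have "\<dots> \<le> 2 * card G"
        by (rule frame_sum[of _ _ _ _ z1 z2 t1 t2])
          (use fins finFG bd bd' in1 in \<open>auto simp: Bd_def E0_def G_def GG_def\<close>)
      also have "(\<Sum>(z,t)\<in>Bd. g z t) = (\<Sum>(z,t)\<in>Zs \<times> {t1,t2}. g z t) + (\<Sum>(z,t)\<in>{z1,z2} \<times> E0. g z t)"
        unfolding Bd_def by (rule sum.union_disjoint) (use fins in \<open>auto simp: E0_def\<close>)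
      also have "(\<Sum>(z,t)\<in>Zs \<times> {t1,t2}. g z t) = (\<Sum>z\<in>Zs. g z t1) + (\<Sum>z\<in>Zs. g z t2)"
        using t12 fins by (simp add: sum.cartesian_product[symmetric] sum.distrib)
      also have "(\<Sum>(z,t)\<in>{z1,z2} \<times> E0. g z t) = (\<Sum>t\<in>E0. g z1 t) + (\<Sum>t\<in>E0. g z2 t)"
        using z12 by (simp add: sum.cartesian_product[symmetric])
      finally have tot: "(\<Sum>z\<in>Zs. g z t1) + (\<Sum>z\<in>Zs. g z t2) + ((\<Sum>t\<in>E0. g z1 t) + (\<Sum>t\<in>E0. g z2 t)) \<le> 2 * card G" .
      have "E0 \<subseteq> Es" by (auto simp: E0_def)
      have "sum b Es = b t1 + (b t2 + sum b E0)"
        using in1 t12 fins unfolding E0_def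
        by (metis Diff_insert2 finite_Diff insert_Diff insert_iff sum.remove)
      then have "sum b Es \<le> 2 * \<kappa> + sum b E0" using bk[of t1] bk[of t2] by simp
      \<comment> \<open>Adding two rows and two columns bounds twice the unmet demand by
        \<open>4 * \<epsilon> + 2 * card G\<close>, up to the corners; this is halved.\<close>
      then show ?thesis
        using tot row[OF in1(3) subset_refl] row[OF in1(4) subset_refl]
          col[OF in1(1) \<open>E0 \<subseteq> Es\<close>] col[OF in1(2) \<open>E0 \<subseteq> Es\<close>] by linarith
    qed
    then show ?thesis using sa sb card_GG by simp
  qed
qed

end

section \<open>Cuts, and the step from \<open>D\<close> to \<open>D + 2\<close>\<close>

definition "cuts P al I a b = {h \<in> P. al h a = al h b \<and> cst (al h) (I - {a, b})}"

context split_pair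
begin

lemma DD_cuts: "DD = cuts P al I p p'"
  by (simp add: DD_def cuts_def V_def)

text \<open>A cut of \<open>p, r\<close> is constant on the complement, which contains
  \<open>p'\<close> and \<open>s\<close>. Equal values at \<open>p\<close> and \<open>p'\<close>
  would make it constant on \<open>I\<close>, so it separates \<open>p\<close> from
  \<open>p'\<close> and \<open>r\<close> from \<open>s\<close>.\<close>

lemma cuts_mixed:
  assumes rs: "r \<in> V" "s \<in> V" "r \<noteq> s" and h: "h \<in> cuts P al I p r"
  shows "h \<in> GG" "al h r \<noteq> al h s" "al h p \<noteq> al h p'"
proof -
  have hP: "h \<in> P" and pr: "al h p = al h r" and c: "cst (al h) (I - {p, r})" using h by (auto simp: cuts_def)
  have mem: "p' \<in> I - {p, r}" "s \<in> I - {p, r}" using rs VI p by auto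
  show pp: "al h p \<noteq> al h p'"
  proof
    assume e: "al h p = al h p'"
    have "al h i = al h p" if "i \<in> I" for i
      using that pr e cstD[OF c _ mem(1), of i] by (cases "i = p \<or> i = r") auto
    then have "cst (al h) I" unfolding cst_def by metis
    then show False using nonconst[OF hP] by simp
  qed
  have "al h s = al h p'" using cstD[OF c mem(2) mem(1)] .
  then show rs': "al h r \<noteq> al h s" using pp pr by simp
  then have "\<not> cst (al h) V" using cstD[of "al h" V r s] rs by blast
  then show "h \<in> GG" using hP pp by (simp add: GG_def)
qed

text \<open>For a pair \<open>p, p'\<close> with the fewest cuts, both summands are at least
  \<open>card DD\<close>. So the planes that spoil levels force twice as many planes in general
  position, all absent from the first alternative of \<open>edge_bound\<close>.\<close>

lemma card_mixed:
  assumes rs: "r \<in> V" "s \<in> V" "r \<noteq> s"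
  shows "card (cuts P al I p r) + card (cuts P al I p s) \<le> card {h\<in>GG. al h r \<noteq> al h s}"
proof -
  have "cuts P al I p r \<inter> cuts P al I p s = {}"
  proof -
    have False if h: "h \<in> cuts P al I p r" "h \<in> cuts P al I p s" for h
    proof -
      have "r \<in> I - {p, s}" "p' \<in> I - {p, s}" using rs VI p by auto
      then have "al h r = al h p'" using h(2) cstD[of "al h" "I - {p, s}" r p'] by (simp add: cuts_def)
      moreover have "al h p = al h r" using h(1) by (simp add: cuts_def)
      ultimately show False using cuts_mixed(3)[OF rs h(1)] by simp
    qed
    then show ?thesis by blast
  qed
  moreover have "finite (cuts P al I p r)" "finite (cuts P al I p s)" using fP by (auto simp: cuts_def)
  ultimately have "card (cuts P al I p r) + card (cuts P al I p s) = card (cuts P al I p r \<union> cuts P al I p s)"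
    by (simp add: card_Un_disjoint)
  also have "\<dots> \<le> card {h\<in>GG. al h r \<noteq> al h s}"
  proof (rule card_mono)
    have "h \<in> GG \<and> al h r \<noteq> al h s" if "h \<in> cuts P al I p s" for h
      using cuts_mixed[OF rs(2,1) rs(3)[symmetric] that] by auto
    then show "cuts P al I p r \<union> cuts P al I p s \<subseteq> {h\<in>GG. al h r \<noteq> al h s}"
      using cuts_mixed[OF rs] by auto
  qed (use fin in auto)
  finally show ?thesis .
qed

end

text \<open>Take the pair \<open>p, p'\<close> with the fewest cuts, say \<open>\<delta>\<close> many. For a counterexample, every level \<open>c\<close> of \<open>x p + x p'\<close> just
  above \<open>card AA / q\<close> (by \<open>slab_bound\<close>) and just below \<open>n - card BB / q\<close> (by \<open>edge_bound\<close>) is blocked;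
  this makes more than \<open>\<delta>\<close> blocked levels, while each cut blocks at most one.\<close>

lemma corner_step:
  assumes ih: "corner q \<kappa> m" and m: "2 \<le> m" and q: "2 \<le> q" "q \<le> 3"
  shows "corner q (\<kappa> + q - 1) (m + 2)"
proof -
  obtain K where K: "\<And>U I P al ka y n \<epsilon>.
     finite U \<Longrightarrow> I \<subseteq> U \<Longrightarrow> card I = m \<Longrightarrow> finite P \<Longrightarrow> (\<forall>h\<in>P. \<not> cst (al h) I) \<Longrightarrow>
     (\<forall>x\<in>simplex I n y. \<forall>r\<in>I. \<forall>s\<in>I. r \<noteq> s \<longrightarrow> deficit U al ka P \<kappa> r s x \<le> \<epsilon>) \<Longrightarrow>
     q * n \<le> card P + 2 * \<epsilon> + K"
    using ih unfolding corner_def by metis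
  define K' where "K' = K + q + 4 * \<kappa>"
  show ?thesis unfolding corner_def
  proof (intro exI[of _ K'] allI impI)
    fix U I P :: "nat set" and al :: "nat \<Rightarrow> nat \<Rightarrow> real" and ka y n \<epsilon>
    assume a: "finite U" "I \<subseteq> U" "card I = m + 2" "finite P" "\<forall>h\<in>P. \<not> cst (al h) I"
      and e: "\<forall>x\<in>simplex I n y. \<forall>r\<in>I. \<forall>s\<in>I. r \<noteq> s \<longrightarrow> deficit U al ka P (\<kappa> + q - 1) r s x \<le> \<epsilon>"
    show "q * n \<le> card P + 2 * \<epsilon> + K'"
    proof (rule ccontr)
      assume neg: "\<not> ?thesis"
      have fI: "finite I" using a finite_subset by blast
      obtain B where "B \<subseteq> I" "card B = 2" using obtain_subset_with_card_n[of 2 I] a(3) by auto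
      then obtain a0 b0 where "a0 \<in> I" "b0 \<in> I" "a0 \<noteq> b0" by (metis card_2_iff insert_subset)
      then have "\<exists>w. (case w of (c,d) \<Rightarrow> c \<in> I \<and> d \<in> I \<and> c \<noteq> d) \<and>
          (\<forall>w'. (case w' of (c,d) \<Rightarrow> c \<in> I \<and> d \<in> I \<and> c \<noteq> d) \<longrightarrow>
             (case w of (c,d) \<Rightarrow> card (cuts P al I c d)) \<le> (case w' of (c,d) \<Rightarrow> card (cuts P al I c d)))"
        by (intro ex_has_least_nat[of _ "(a0,b0)"]) simp
      then obtain p p' where p: "p \<in> I" "p' \<in> I" "p \<noteq> p'"
        and mn: "\<And>c d. c \<in> I \<Longrightarrow> d \<in> I \<Longrightarrow> c \<noteq> d \<Longrightarrow> card (cuts P al I p p') \<le> card (cuts P al I c d)"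
        by auto
      interpret split_pair U I P al ka y n \<epsilon> q \<kappa> p p'
        by unfold_locales (use a e p q in auto)
      define \<delta> where "\<delta> = card DD"
      have cV: "card V = m" using a(3) p fI unfolding V_def by (simp add: card_Diff_subset)
      have G2: "2 * \<delta> \<le> card {h\<in>GG. al h r \<noteq> al h s}" if "r \<in> V" "s \<in> V" "r \<noteq> s" for r s
        using card_mixed[OF that] mn[of p r] mn[of p s] that VI p unfolding \<delta>_def DD_cuts by fastforce
      have G2': "2 * \<delta> \<le> card GG"
      proof -
        obtain B where "B \<subseteq> V" "card B = 2" using obtain_subset_with_card_n[of 2 V] cV m by auto
        then obtain r s where "r \<in> V" "s \<in> V" "r \<noteq> s" by (metis card_2_iff insert_subset)
        then have "2 * \<delta> \<le> card {h\<in>GG. al h r \<noteq> al h s}" by (rule G2)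
        also have "\<dots> \<le> card GG" by (rule card_mono) (use fin in auto)
        finally show ?thesis .
      qed
      \<comment> \<open>The \<open>\<delta>\<close> planes of \<open>DD\<close> do not help on a
        slice that is not blocked. This gain in \<open>slab_bound\<close> is the length of the left
        window.\<close>
      have L: "c \<in> blocked" if c: "c \<le> n" "q * (c + 1) > card AA" "q * c \<le> card AA + \<delta>" for c
      proof (rule ccontr)
        assume nb: "c \<notin> blocked"
        have "card AA + card DD + q * (n - c) \<le> card P + 2 * \<epsilon> + K"
          by (rule slab_bound[OF _ c(1) nb c(2)]) (use K[OF fU VI(2) cV] in blast)
        moreover have "q * (n - c) + q * c = q * n" using c(1) by (simp add: add_mult_distrib2[symmetric])
        ultimately show False using neg c(3) unfolding K'_def \<delta>_def by linarith
      qed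
      have R: "c \<in> blocked" if c: "c \<le> n" "q * (n - c) > card BB + K" "q * (n - c) \<le> card BB + 2 * \<delta> + K + q" for c
      proof (rule ccontr)
        assume nb: "c \<notin> blocked"
        define v where "v = q * (n - c) - card BB"
        \<comment> \<open>The largest deficit bound that the induction hypothesis for
          \<open>BB\<close> alone refutes. It yields a line with deficit at least
          \<open>(v - K) / 2\<close>. Only half of \<open>v\<close> is lost in this way, which lets
          the right window have length \<open>2 * \<delta>\<close>.\<close>
        define e' where "e' = (v - K - 1) div 2"
        have v: "v > K" "q * (n - c) = card BB + v" using c(2) by (auto simp: v_def)
        have "2 * e' \<le> v - K - 1" by (simp add: e'_def)
        then have "\<not> q * (n - c) \<le> card BB + 2 * e' + K" using v by linarith
        then have "\<not> (\<forall>x\<in>simplex V (n - c) (y(p := c, p' := 0)). \<forall>r\<in>V. \<forall>s\<in>V. r \<noteq> s \<longrightarrow> deficit U al ka BB \<kappa> r s x \<le> e')"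
        proof (rule contrapos_nn)
          have "\<forall>h\<in>BB. \<not> cst (al h) V" using slab_nonconst by blast
          then show "q * (n - c) \<le> card BB + 2 * e' + K"
            if "\<forall>x\<in>simplex V (n - c) (y(p := c, p' := 0)). \<forall>r\<in>V. \<forall>s\<in>V. r \<noteq> s \<longrightarrow> deficit U al ka BB \<kappa> r s x \<le> e'"
            using K[OF fU VI(2) cV fin(2) _ that] by blast
        qed
        then obtain x r s where x: "x \<in> simplex V (n - c) (y(p := c, p' := 0))"
          and rs: "r \<in> V" "s \<in> V" "r \<noteq> s" and d: "deficit U al ka BB \<kappa> r s x > e'"
          by (auto simp: not_le)
        let ?d = "deficit U al ka BB \<kappa> r s x"
        have d2: "2 * ?d \<ge> v - K" using d unfolding e'_def by linarith
        have qc: "q * (n - c) + q * c = q * n" using c(1) by (simp add: add_mult_distrib2[symmetric])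
        have split: "card GG = card {h\<in>GG. al h r = al h s} + card {h\<in>GG. al h r \<noteq> al h s}"
          using card_split[OF fin(3), of "\<lambda>_. True" "\<lambda>h. al h r = al h s"] by simp
        from edge_bound[OF c(1) nb rs x] d
        consider "q * c \<le> card AA + card {h\<in>GG. al h r = al h s}"
          | "q * c + ?d \<le> card AA + card GG + 2 * \<epsilon> + 2 * \<kappa>" by linarith
        then show False
        proof cases
          \<comment> \<open>At least \<open>2 * \<delta>\<close> planes of \<open>GG\<close>
            distinguish \<open>r\<close> from \<open>s\<close> and are missing on the right-hand
            side; this exhausts the window as well.\<close>
          case 1
          then show False using G2[OF rs] split card_P neg v qc c(3) unfolding K'_def \<delta>_def by linarith
        next
          case 2
          then show False using d2 card_P neg v qc c(3) unfolding K'_def \<delta>_def by linarith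
        qed
      qed
      \<comment> \<open>This keeps the two windows, of lengths \<open>\<delta>\<close> and
        \<open>2 * \<delta>\<close> in units of \<open>q * c\<close>, disjoint and inside
        \<open>{0..n}\<close>.\<close>
      have big: "q * n > card AA + card BB + 3 * \<delta> + K + q"
        using neg G2' card_P unfolding K'_def \<delta>_def by linarith
      define S where "S = (\<lambda>j. card AA div q + j) ` {0..\<delta> div q}"
      define T where "T = (\<lambda>j. n - ((card BB + K) div q + 1 + j)) ` {0..2 * \<delta> div q}"
      have q0: "q > 0" using q by simp
      have Sb: "c \<in> blocked \<and> q * c \<le> card AA + \<delta>" if "c \<in> S" for c
      proof -
        have "\<exists>j\<in>{0..\<delta> div q}. c = card AA div q + j" using that unfolding S_def by blast
        then obtain j where j: "c = card AA div q + j" "j \<le> \<delta> div q" by auto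
        have "q * j \<le> q * (\<delta> div q)" using j(2) by (rule mult_le_mono2)
        then have "q * j \<le> \<delta>" using times_div_less_eq_dividend[of q \<delta>] by linarith
        moreover have "q * (card AA div q) \<le> card AA" by simp
        ultimately have 1: "q * c \<le> card AA + \<delta>" unfolding j(1) add_mult_distrib2 by linarith
        have "card AA < q * (card AA div q + 1)" using q0 dividend_less_times_div[of q "card AA"] by (simp add: add_mult_distrib2)
        also have "\<dots> \<le> q * (c + 1)" by (rule mult_le_mono2) (simp add: j)
        finally have 2: "q * (c + 1) > card AA" .
        have "q * c < q * n" using 1 big by linarith
        then have "c \<le> n" by simp
        then show ?thesis using L 1 2 by blast
      qed
      have T': "(card BB + K) div q + 1 + j \<le> n \<and> q * ((card BB + K) div q + 1 + j) > card BB + K \<and>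
          q * ((card BB + K) div q + 1 + j) \<le> card BB + 2 * \<delta> + K + q" if "j \<le> 2 * \<delta> div q" for j
      proof -
        have "q * j \<le> q * (2 * \<delta> div q)" using that by (rule mult_le_mono2)
        then have "q * j \<le> 2 * \<delta>" using times_div_less_eq_dividend[of q "2 * \<delta>"] by linarith
        moreover have "q * ((card BB + K) div q) \<le> card BB + K" by simp
        ultimately have 1: "q * ((card BB + K) div q + 1 + j) \<le> card BB + 2 * \<delta> + K + q"
          unfolding add_mult_distrib2 by linarith
        have "card BB + K < q * ((card BB + K) div q + 1)"
          using q0 dividend_less_times_div[of q "card BB + K"] by (simp add: add_mult_distrib2)
        also have "\<dots> \<le> q * ((card BB + K) div q + 1 + j)" by (rule mult_le_mono2) simp
        finally have 2: "q * ((card BB + K) div q + 1 + j) > card BB + K" .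
        have "q * ((card BB + K) div q + 1 + j) < q * n" using 1 big by linarith
        then have "(card BB + K) div q + 1 + j < n" unfolding nat_mult_less_cancel_disj by blast
        then show ?thesis using 1 2 by simp
      qed
      have Tb: "c \<in> blocked \<and> c \<le> n \<and> q * (n - c) \<le> card BB + 2 * \<delta> + K + q" if "c \<in> T" for c
      proof -
        have "\<exists>j\<in>{0..2 * \<delta> div q}. c = n - ((card BB + K) div q + 1 + j)" using that unfolding T_def by blast
        then obtain j where j: "c = n - ((card BB + K) div q + 1 + j)" "j \<le> 2 * \<delta> div q" by auto
        have nc: "n - c = (card BB + K) div q + 1 + j" "c \<le> n" using T'[OF j(2)] j(1) by auto
        show ?thesis using R[of c] T'[OF j(2)] nc by simp
      qed
      have "S \<inter> T = {}"
      proof -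
        have False if "c \<in> S" "c \<in> T" for c
        proof -
          have "q * (n - c) + q * c = q * n" using Tb[OF that(2)] by (simp add: add_mult_distrib2[symmetric])
          then show False using Sb[OF that(1)] Tb[OF that(2)] big by linarith
        qed
        then show ?thesis by blast
      qed
      moreover have "finite S" "finite T" by (auto simp: S_def T_def)
      moreover have "card S = \<delta> div q + 1" unfolding S_def by (subst card_image) (auto simp: inj_on_def)
      moreover have "card T = 2 * \<delta> div q + 1"
      proof -
        have "inj_on (\<lambda>j. n - ((card BB + K) div q + 1 + j)) {0..2 * \<delta> div q}"
        proof (rule inj_onI)
          fix j j' assume j: "j \<in> {0..2 * \<delta> div q}" "j' \<in> {0..2 * \<delta> div q}"
            and eq: "n - ((card BB + K) div q + 1 + j) = n - ((card BB + K) div q + 1 + j')"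
          have "(card BB + K) div q + 1 + j \<le> n" "(card BB + K) div q + 1 + j' \<le> n"
            using T'[of j] T'[of j'] j by simp_all
          then show "j = j'" using eq by linarith
        qed
        then show ?thesis unfolding T_def by (subst card_image) auto
      qed
      ultimately have cST: "card (S \<union> T) = \<delta> div q + 2 * \<delta> div q + 2" by (simp add: card_Un_disjoint)
      have "S \<union> T \<subseteq> blocked" using Sb Tb by blast
      moreover have "finite blocked" by (rule finite_subset[of _ "{..n}"]) (auto simp: blocked_def)
      ultimately have "card (S \<union> T) \<le> \<delta>" using card_mono card_blocked \<delta>_def by (metis le_trans)
      \<comment> \<open>Each rounding loses less than one level, so the count exceeds
        \<open>3 * \<delta> / q\<close>, which is at least \<open>\<delta>\<close> because
        \<open>q \<le> 3\<close>.\<close>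
      moreover have "\<delta> div q + 2 * \<delta> div q + 2 > \<delta>"
      proof -
        have "q = 2 \<or> q = 3" using q by linarith
        moreover have "d div 2 + 2 * d div 2 + 2 > d" "d div 3 + 2 * d div 3 + 2 > d" for d :: nat
          by presburger+
        ultimately show ?thesis by metis
      qed
      ultimately show False using cST by linarith
    qed
  qed
qed

section \<open>The triangle: three coordinates and demand 4\<close>

lemma ev_side:
  assumes "finite U" "j \<in> U" "k \<in> U" "j \<noteq> k" "z j = 0" "z k = 0" "t \<le> n"
  shows "ev U f (z(k := n, j := t, k := n - t)) = ev U f z + f j * real t + f k * real (n - t)"
  using assms by (simp add: ev_upd of_nat_diff algebra_simps)

text \<open>At most two planes contain the side, so at each of the \<open>n - 1\<close> inner points
  a demand of 2 is left to planes that meet the side only once. The vertices are left out because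
  only inner points give strict signs in \<open>side_sign\<close>.\<close>

lemma side_bound:
  assumes U: "finite U" "j \<in> U" "k \<in> U" "j \<noteq> k" and z: "z j = 0" "z k = 0" and fP: "finite P"
    and d: "deficit U al ka P 4 j k (z(k := n)) \<le> \<epsilon>"
    and W: "card {h\<in>P. al h j = al h k \<and> ev U (al h) z + al h k * real n = ka h} \<le> 2"
  shows "2 * (n - 1) \<le> \<epsilon> + card {h\<in>P. al h j \<noteq> al h k \<and>
      (\<exists>t. 0 < t \<and> t < n \<and> ev U (al h) z + al h j * real t + al h k * real (n - t) = ka h)}"
    (is "_ \<le> _ + card ?H")
proof -
  define pt where "pt t = z(k := n, j := t, k := n - t)" for t
  have evp: "ev U f (pt t) = ev U f z + f j * real t + f k * real (n - t)" if "t \<le> n" for f t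
    unfolding pt_def by (rule ev_side) (use U z that in auto)
  have fH: "finite ?H" using fP by simp
  let ?h = "\<lambda>t. card {h\<in>?H. ev U (al h) z + al h j * real t + al h k * real (n - t) = ka h}"
  have c: "cov U al ka P (pt t) \<le> 2 + ?h t" if t: "t \<in> {1..<n}" for t
  proof -
    have "cov U al ka P (pt t) = card {h\<in>P. ev U (al h) (pt t) = ka h \<and> al h j = al h k} +
        card {h\<in>P. ev U (al h) (pt t) = ka h \<and> al h j \<noteq> al h k}"
      unfolding cov_def by (rule card_split[OF fP])
    also have "{h\<in>P. ev U (al h) (pt t) = ka h \<and> al h j = al h k}
        = {h\<in>P. al h j = al h k \<and> ev U (al h) z + al h k * real n = ka h}"
    proof -
      have "ev U (al h) (pt t) = ev U (al h) z + al h k * real n" if "al h j = al h k" for h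
      proof -
        have "ev U (al h) (pt t) = ev U (al h) z + al h k * (real t + real (n - t))"
          using t that by (simp add: evp algebra_simps)
        also have "real t + real (n - t) = real n" using t by simp
        finally show ?thesis .
      qed
      then show ?thesis by auto
    qed
    also have "{h\<in>P. ev U (al h) (pt t) = ka h \<and> al h j \<noteq> al h k}
        = {h\<in>?H. ev U (al h) z + al h j * real t + al h k * real (n - t) = ka h}"
    proof -
      have "0 < t" "t < n" using t by auto
      then show ?thesis unfolding evp[OF less_imp_le[OF \<open>t < n\<close>]] by blast
    qed
    finally show ?thesis using W by linarith
  qed
  have "(\<Sum>t\<in>{1..<n}. ?h t) \<le> card ?H"
  proof (rule sum_card_le)
    fix h t t' assume h: "h \<in> ?H" "t \<in> {1..<n}" "t' \<in> {1..<n}"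
      and e: "ev U (al h) z + al h j * real t + al h k * real (n - t) = ka h"
        "ev U (al h) z + al h j * real t' + al h k * real (n - t') = ka h"
    have "(al h j - al h k) * real t = (al h j - al h k) * real t'"
      using e h by (simp add: of_nat_diff algebra_simps)
    then show "t = t'" using h by simp
  qed (use fH in auto)
  moreover have "(\<Sum>t\<in>{1..<n}. 4 - cov U al ka P (pt t)) \<le> \<epsilon>"
  proof -
    have "(\<Sum>t\<in>{1..<n}. 4 - cov U al ka P (pt t)) \<le> (\<Sum>t\<le>n. 4 - cov U al ka P (pt t))"
      by (rule sum_mono2) auto
    also have "\<dots> = deficit U al ka P 4 j k (z(k := n))"
      using U z by (simp add: deficit_def pt_def)
    finally show ?thesis using d by linarith
  qed
  moreover have "(\<Sum>t\<in>{1..<n}. 4) \<le> (\<Sum>t\<in>{1..<n}. (4 - cov U al ka P (pt t)) + 2 + ?h t)"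
    by (rule sum_mono) (use c in fastforce)
  then have "4 * (n - 1) \<le> (\<Sum>t\<in>{1..<n}. 4 - cov U al ka P (pt t)) + 2 * (n - 1) + (\<Sum>t\<in>{1..<n}. ?h t)"
    unfolding sum.distrib sum_constant card_atLeastLessThan by (simp only: of_nat_id mult.commute)
  moreover have "2 * (n - 1) \<le> e + H" if "s \<le> H" "d \<le> e" "4 * (n - 1) \<le> d + 2 * (n - 1) + s" for s d e H
    using that by linarith
  ultimately show ?thesis by blast
qed

lemma card_three:
  assumes "finite P" "A \<subseteq> P" "B \<subseteq> P" "C \<subseteq> P" "A \<inter> B \<inter> C = {}"
  shows "card A + card B + card C \<le> 2 * card P"
proof -
  have f: "finite A" "finite B" "finite C" using assms finite_subset by blast+
  have "card A + card B = card (A \<union> B) + card (A \<inter> B)" by (rule card_Un_Int[OF f(1,2)])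
  moreover have "card (A \<inter> B) + card C = card (A \<inter> B \<union> C)"
    using f assms(5) by (subst card_Un_disjoint) auto
  moreover have "card (A \<union> B) \<le> card P" "card (A \<inter> B \<union> C) \<le> card P"
    using assms by (auto intro!: card_mono)
  ultimately show ?thesis by linarith
qed

text \<open>The value at an inner point of a side is a positive combination of the values at its
  ends. If it is 0 and the ends differ, they have opposite signs. Three vertex values cannot have
  pairwise opposite signs, so no plane crosses all three sides at inner points.\<close>

lemma side_sign:
  fixes C fj fk ka :: real
  assumes "fj \<noteq> fk" "0 < t" "t < n" "C + fj * real t + fk * real (n - t) = ka"
  shows "(C + real n * fj - ka) * (C + real n * fk - ka) < 0"
proof -
  let ?a = "C + real n * fj - ka" and ?b = "C + real n * fk - ka"
  have n: "real n = real t + real (n - t)" using assms by simp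
  have "real t * ?a + real (n - t) * ?b = (real t + real (n - t)) * (C + fj * real t + fk * real (n - t) - ka)"
    unfolding n by (simp add: algebra_simps)
  also have "\<dots> = 0" using assms by simp
  finally have e: "real t * ?a = - (real (n - t) * ?b)" by linarith
  have "?a \<noteq> ?b" using assms by simp
  have p: "real t > 0" "real (n - t) > 0" using assms by simp_all
  consider "?b = 0" | "?b > 0" | "?b < 0" by linarith
  then show ?thesis
  proof cases
    case 1
    then have "?a = 0" using e p by simp
    then show ?thesis using 1 \<open>?a \<noteq> ?b\<close> by simp
  next
    case 2
    then have "real t * ?a < 0" using e p by simp
    then have "?a < 0" using p by (simp add: mult_less_0_iff)
    then show ?thesis using 2 by (simp add: mult_less_0_iff)
  next
    case 3
    then have "real t * ?a > 0" using e p by (simp add: mult_less_0_iff)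
    then have "?a > 0" using p by (simp add: zero_less_mult_iff)
    then show ?thesis using 3 by (simp add: mult_less_0_iff)
  qed
qed

text \<open>Translation by a unit of coordinate \<open>i\<close> carries lines into lines. If
  \<open>i\<close> is \<open>r\<close> or \<open>s\<close>, the target line has one more point, and
  this can only add to its deficit.\<close>

lemma deficit_shift:
  assumes "r \<noteq> s" and c: "\<And>w. cov U al ka' P' w = cov U al ka P (w(i := Suc (w i)))"
  shows "deficit U al ka' P' \<kappa> r s x \<le> deficit U al ka P \<kappa> r s (x(i := Suc (x i)))"
proof -
  let ?x = "x(i := Suc (x i))"
  consider "i \<noteq> r" "i \<noteq> s" | "i = r" | "i = s" by blast
  then show ?thesis
  proof cases
    case 1
    have "x(r := t, s := x r + x s - t, i := Suc ((x(r := t, s := x r + x s - t)) i))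
        = ?x(r := t, s := x r + x s - t)" for t
      using 1 assms(1) by auto
    then show ?thesis using 1 by (simp add: deficit_def c)
  next
    case 2
    have "x(r := t, s := x r + x s - t, i := Suc ((x(r := t, s := x r + x s - t)) i))
        = ?x(r := Suc t, s := ?x r + ?x s - Suc t)" for t
      using 2 assms(1) by auto
    then have "deficit U al ka' P' \<kappa> r s x
        = (\<Sum>t\<le>x r + x s. \<kappa> - cov U al ka P (?x(r := Suc t, s := ?x r + ?x s - Suc t)))"
      by (simp only: deficit_def c)
    also have "\<dots> = (\<Sum>t\<in>Suc ` {..x r + x s}. \<kappa> - cov U al ka P (?x(r := t, s := ?x r + ?x s - t)))"
      by (subst sum.reindex) (auto simp: o_def)
    also have "\<dots> \<le> deficit U al ka P \<kappa> r s ?x"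
      unfolding deficit_def by (rule sum_mono2) (use 2 assms(1) in auto)
    finally show ?thesis .
  next
    case 3
    have "x(r := t, s := x r + x s - t, i := Suc ((x(r := t, s := x r + x s - t)) i))
        = ?x(r := t, s := ?x r + ?x s - t)" if "t \<le> x r + x s" for t
      using 3 assms(1) that by (auto simp: Suc_diff_le)
    then have "deficit U al ka' P' \<kappa> r s x
        = (\<Sum>t\<le>x r + x s. \<kappa> - cov U al ka P (?x(r := t, s := ?x r + ?x s - t)))"
      unfolding deficit_def c by (intro sum.cong) auto
    also have "\<dots> \<le> deficit U al ka P \<kappa> r s ?x"
      unfolding deficit_def by (rule sum_mono2) (use 3 assms(1) in auto)
    finally show ?thesis .
  qed
qed

text \<open>Three planes through the side \<open>x i = 0\<close> pay for one layer at slope 3. They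
  miss all points with \<open>x i > 0\<close>, and these form a translate of the triangle of size
  \<open>n - 1\<close>; \<open>ka'\<close> expresses the translation.\<close>

lemma corner_triangle_peel:
  assumes U: "finite U" "I \<subseteq> U" "I = {i,j,k}" "i \<noteq> j" "i \<noteq> k" "j \<noteq> k" and fP: "finite P"
    and nc: "\<forall>h\<in>P. \<not> cst (al h) I"
    and z: "z i = 0" "z j = 0" "z k = 0" "\<And>l. l \<notin> I \<Longrightarrow> z l = y l"
    and n: "0 < n"
    and d: "\<forall>x\<in>simplex I n y. \<forall>r\<in>I. \<forall>s\<in>I. r \<noteq> s \<longrightarrow> deficit U al ka P \<kappa> r s x \<le> \<epsilon>"
    and W: "card {h\<in>P. al h j = al h k \<and> ev U (al h) z + al h k * real n = ka h} \<ge> 3" (is "card ?W \<ge> 3")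
    and IH: "\<And>P ka. finite P \<Longrightarrow> \<forall>h\<in>P. \<not> cst (al h) I \<Longrightarrow>
      \<forall>x\<in>simplex I (n - 1) y. \<forall>r\<in>I. \<forall>s\<in>I. r \<noteq> s \<longrightarrow> deficit U al ka P \<kappa> r s x \<le> \<epsilon> \<Longrightarrow>
      3 * (n - 1) \<le> card P + K"
  shows "3 * n \<le> card P + K"
proof -
  define ka' where "ka' h = ka h - al h i" for h
  have iU: "i \<in> U" "k \<in> U" "j \<in> U" using U by auto
  have notW: "h \<notin> ?W" if "h \<in> P" "w \<in> simplex I (n - 1) y" "ev U (al h) (w(i := Suc (w i))) = ka h" for h w
  proof
    assume hW: "h \<in> ?W"
    have s: "w i + w j + w k = n - 1" and o: "\<And>l. l \<notin> I \<Longrightarrow> w l = y l"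
      using that(2) U(4-6) unfolding simplex_def U(3) by (auto simp: add.assoc)
    let ?w = "w(i := Suc (w i))"
    have eq: "ev U (al h) v = ev U (al h) (\<lambda>l. if l \<in> I then 0 else y l) + al h i * real (v i) + al h k * real (v j + v k)"
      if "\<And>l. l \<notin> I \<Longrightarrow> v l = y l" for v
    proof -
      have jk: "al h j = al h k" using hW by simp
      have "v = (\<lambda>l. if l \<in> I then 0 else y l)(i := v i, j := v j, k := v k)"
        using that U(3-6) by (auto simp: fun_eq_iff)
      then have "ev U (al h) v = ev U (al h) ((\<lambda>l. if l \<in> I then 0 else y l)(i := v i, j := v j, k := v k))" by simp
      also have "\<dots> = ev U (al h) (\<lambda>l. if l \<in> I then 0 else y l) + al h i * real (v i) + al h j * real (v j) + al h k * real (v k)"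
        using U iU by (simp add: ev_upd)
      finally show ?thesis using jk by (simp add: algebra_simps)
    qed
    have 1: "ev U (al h) ?w = ev U (al h) (\<lambda>l. if l \<in> I then 0 else y l) + al h i * real (?w i) + al h k * real (?w j + ?w k)"
      by (rule eq) (use o U(3) in auto)
    have 2: "ev U (al h) z = ev U (al h) (\<lambda>l. if l \<in> I then 0 else y l) + al h i * real (z i) + al h k * real (z j + z k)"
      by (rule eq) (use z in auto)
    have "real n = real (Suc (w i)) + real (w j + w k)" using s n by simp
    then have "al h i * real (Suc (w i)) = al h k * real (Suc (w i))"
      using 1 2 that(3) hW z U(4-6) by (simp add: algebra_simps)
    then have "al h i = al h k" by (metis mult_right_cancel of_nat_eq_0_iff nat.distinct(1))
    then have "al h l = al h k" if "l \<in> I" for l using that hW U(3) by auto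
    then have "cst (al h) I" unfolding cst_def by metis
    then show False using nc that(1) by blast
  qed
  have c: "deficit U al ka' (P - ?W) \<kappa> r s x \<le> \<epsilon>"
    if x: "x \<in> simplex I (n - 1) y" and rs: "r \<in> I" "s \<in> I" "r \<noteq> s" for x r s
  proof -
    let ?x = "x(i := Suc (x i))"
    have sh: "ev U (al h) (w(i := Suc (w i))) = ev U (al h) w + al h i" for h w
      using U iU by (simp add: ev_upd)
    have "deficit U al ka' (P - ?W) \<kappa> r s x = deficit U al ka' P \<kappa> r s x"
    proof -
      have "cov U al ka' (P - ?W) w = cov U al ka' P w" if "w \<in> simplex I (n - 1) y" for w
      proof -
        have "{h \<in> P - ?W. ev U (al h) w = ka' h} = {h \<in> P. ev U (al h) w = ka' h}"
        proof -
          have "h \<notin> ?W" if "h \<in> P" "ev U (al h) w = ka' h" for h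
            using notW[OF that(1) \<open>w \<in> _\<close>] that(2) sh[of h w] by (simp add: ka'_def)
          then show ?thesis by blast
        qed
        then show ?thesis by (simp only: cov_def)
      qed
      moreover have "x(r := t, s := x r + x s - t) \<in> simplex I (n - 1) y" if "t \<le> x r + x s" for t
        using simplex_line[OF x _ rs that] U finite_subset by blast
      ultimately show ?thesis unfolding deficit_def by simp
    qed
    also have "\<dots> \<le> deficit U al ka P \<kappa> r s ?x"
    proof (rule deficit_shift[OF rs(3)])
      fix w show "cov U al ka' P w = cov U al ka P (w(i := Suc (w i)))"
        by (simp add: cov_def sh ka'_def algebra_simps eq_diff_eq)
    qed
    also have "\<dots> \<le> \<epsilon>"
    proof -
      have "sum x I = n - 1" "sum ?x I = Suc (sum x I)"
        using x U by (auto simp: simplex_def)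
      then have "?x \<in> simplex I n y" using x U n by (auto simp: simplex_def)
      then show ?thesis using d rs by blast
    qed
    finally show ?thesis .
  qed
  have "3 * (n - 1) \<le> card (P - ?W) + K"
    by (rule IH[of _ ka']) (use fP nc c in auto)
  moreover have "card (P - ?W) = card P - card ?W" by (rule card_Diff_subset) (use fP in auto)
  moreover have "card ?W \<le> card P" by (rule card_mono) (use fP in auto)
  ultimately show ?thesis using W n by linarith
qed

text \<open>Either a side lies in three planes and is peeled off, or each of the three sides needs
  \<open>2 * (n - 1) - \<epsilon>\<close> crossing planes. A plane crosses at most two sides, so
  \<open>6 * (n - 1) \<le> 2 * card P + 3 * \<epsilon>\<close>.\<close>

lemma corner_triangle_aux:
  assumes U: "finite U" "I \<subseteq> U" "I = {i,j,k}" "i \<noteq> j" "i \<noteq> k" "j \<noteq> k"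
    and z: "z i = 0" "z j = 0" "z k = 0" "\<And>l. l \<notin> I \<Longrightarrow> z l = y l"
  shows "finite P \<Longrightarrow> \<forall>h\<in>P. \<not> cst (al h) I \<Longrightarrow>
    \<forall>x\<in>simplex I n y. \<forall>r\<in>I. \<forall>s\<in>I. r \<noteq> s \<longrightarrow> deficit U al ka P 4 r s x \<le> \<epsilon> \<Longrightarrow>
    3 * n \<le> card P + (2 * \<epsilon> + 3)"
proof (induction n arbitrary: P ka)
  case (Suc m)
  let ?n = "Suc m"
  let ?W = "\<lambda>r s. {h\<in>P. al h r = al h s \<and> ev U (al h) z + al h s * real ?n = ka h}"
  have peel: ?case if "card (?W b c) \<ge> 3" "I = {a,b,c}" "a \<noteq> b" "a \<noteq> c" "b \<noteq> c" "z a = 0" "z b = 0" "z c = 0" for a b c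
    by (rule corner_triangle_peel[OF U(1,2) that(2-5) Suc.prems(1,2) that(6-8) z(4) _ Suc.prems(3) that(1)])
      (use Suc.IH in auto)
  show ?case
  proof (cases "card (?W j k) \<le> 2 \<and> card (?W i k) \<le> 2 \<and> card (?W i j) \<le> 2")
    case False
    then consider "card (?W j k) \<ge> 3" | "card (?W i k) \<ge> 3" | "card (?W i j) \<ge> 3" by linarith
    then show ?thesis
    proof cases
      case 1 then show ?thesis by (rule peel[of j k i]) (use U z in auto)
    next
      case 2 then show ?thesis by (rule peel[of i k j]) (use U z in auto)
    next
      case 3 then show ?thesis by (rule peel[of i j k]) (use U z in auto)
    qed
  next
    case True
    let ?H = "\<lambda>r s. {h\<in>P. al h r \<noteq> al h s \<and>
      (\<exists>t. 0 < t \<and> t < ?n \<and> ev U (al h) z + al h r * real t + al h s * real (?n - t) = ka h)}"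
    have side: "2 * (?n - 1) \<le> \<epsilon> + card (?H r s)" if "card (?W r s) \<le> 2" "r \<in> I" "s \<in> I" "r \<noteq> s" for r s
    proof (rule side_bound[OF U(1) _ _ that(4) _ _ Suc.prems(1) _ that(1)])
      have "sum (z(s := ?n)) I = ?n + sum z (I - {s})"
        using U that by (subst sum.remove[of _ s]) (auto intro: sum.cong)
      also have "sum z (I - {s}) = 0" using z U by auto
      finally have "z(s := ?n) \<in> simplex I ?n y" using that z by (auto simp: simplex_def)
      then show "deficit U al ka P 4 r s (z(s := ?n)) \<le> \<epsilon>" using Suc.prems(3) that by blast
    qed (use U that z in auto)
    have "card (?H j k) + card (?H i k) + card (?H i j) \<le> 2 * card P"
    proof (rule card_three[OF Suc.prems(1)])
      have False if h: "h \<in> ?H j k" "h \<in> ?H i k" "h \<in> ?H i j" for h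
      proof -
        let ?f = "\<lambda>l. ev U (al h) z + real ?n * al h l - ka h"
        have "?f r * ?f s < 0" if "h \<in> ?H r s" for r s
        proof -
          from that obtain t where "al h r \<noteq> al h s" "0 < t" "t < ?n"
            "ev U (al h) z + al h r * real t + al h s * real (?n - t) = ka h" by blast
          then show ?thesis by (rule side_sign)
        qed
        from this[OF h(1)] this[OF h(2)] this[OF h(3)] show False unfolding mult_less_0_iff by linarith
      qed
      then show "?H j k \<inter> ?H i k \<inter> ?H i j = {}" by blast
    qed auto
    moreover have "2 * m \<le> \<epsilon> + card (?H j k)" "2 * m \<le> \<epsilon> + card (?H i k)"
      "2 * m \<le> \<epsilon> + card (?H i j)"
      using side[of j k] side[of i k] side[of i j] True U by auto
    moreover have "3 * m \<le> p + 2 * \<epsilon>"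
      if "a + b + c \<le> 2 * p" "2 * m \<le> \<epsilon> + a" "2 * m \<le> \<epsilon> + b" "2 * m \<le> \<epsilon> + c" for a b c p :: nat
      using that by linarith
    ultimately have "3 * m \<le> card P + 2 * \<epsilon>" by blast
    then show ?thesis by simp
  qed
qed simp

lemma corner_triangle: "corner 3 4 3"
  unfolding corner_def
proof (intro exI[of _ 3] allI impI)
  fix U I P :: "nat set" and al :: "nat \<Rightarrow> nat \<Rightarrow> real" and ka y n \<epsilon>
  assume a: "finite U" "I \<subseteq> U" "card I = 3" "finite P" "\<forall>h\<in>P. \<not> cst (al h) I"
    and e: "\<forall>x\<in>simplex I n y. \<forall>r\<in>I. \<forall>s\<in>I. r \<noteq> s \<longrightarrow> deficit U al ka P 4 r s x \<le> \<epsilon>"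
  obtain i j k where I: "I = {i,j,k}" "i \<noteq> j" "i \<noteq> k" "j \<noteq> k" using a(3) by (metis card_3_iff)
  have "3 * n \<le> card P + (2 * \<epsilon> + 3)"
    by (rule corner_triangle_aux[OF a(1,2) I, of "y(i := 0, j := 0, k := 0)" y, OF _ _ _ _ a(4,5) e])
      (use I in auto)
  then show "3 * n \<le> card P + 2 * \<epsilon> + 3" by simp
qed

section \<open>Slopes 2 and 3 in all dimensions\<close>

lemma corner_two: "1 \<le> r \<Longrightarrow> corner 2 (r + 1) (2 * r)"
proof (induction r rule: nat_induct_at_least)
  case base
  show ?case using corner_base[of 2] by (simp add: numeral_2_eq_2)
next
  case (Suc r)
  have "corner 2 (r + 1 + 2 - 1) (2 * r + 2)" by (rule corner_step[OF Suc.IH]) (use Suc in auto)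
  then show ?case by simp
qed

text \<open>For \<open>q = 3\<close> a step raises both \<open>D\<close> and the demand by 2, so
  each parity needs its own start: the segment and the triangle.\<close>

lemma corner_three: "2 \<le> D \<Longrightarrow> corner 3 (D + 1) D"
proof (induction D rule: less_induct)
  case (less D)
  consider "D = 2" | "D = 3" | "4 \<le> D" using less.prems by linarith
  then show ?case
  proof cases
    case 1 then show ?thesis using corner_base[of 3] by simp
  next
    case 2 then show ?thesis using corner_triangle by simp
  next
    case 3
    then have "corner 3 (D - 2 + 1) (D - 2)" by (intro less.IH) auto
    then have "corner 3 (D - 2 + 1 + 3 - 1) (D - 2 + 2)" by (rule corner_step) (use 3 in auto)
    moreover have "D - 2 + 1 + 3 - 1 = D + 1" "D - 2 + 2 = D" using 3 by auto
    ultimately show ?thesis by (simp only:)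
  qed
qed

section \<open>Planes parallel to a facet, and the step from \<open>D\<close> to
  \<open>D - 1\<close>\<close>

definition covers where
  "covers D \<kappa> U I P al ka y n \<longleftrightarrow> finite U \<and> I \<subseteq> U \<and> card I = D \<and> finite P \<and>
     (\<forall>h\<in>P. \<not> cst (al h) I) \<and> (\<forall>x\<in>simplex I n y. \<kappa> \<le> cov U al ka P x)"

definition lower_slope :: "nat \<Rightarrow> nat \<Rightarrow> real \<Rightarrow> bool" where
  "lower_slope D \<kappa> c \<longleftrightarrow> (\<exists>K\<ge>0. \<forall>U I P al ka y n. covers D \<kappa> U I P al ka y n \<longrightarrow> c * real n \<le> real (card P) + K)"

lemma corner_lower_slope:
  assumes "corner q \<kappa> D"
  shows "lower_slope D \<kappa> (real q)"
proof -
  obtain K where K: "\<And>U I P al ka y n \<epsilon>.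
     finite U \<Longrightarrow> I \<subseteq> U \<Longrightarrow> card I = D \<Longrightarrow> finite P \<Longrightarrow> (\<forall>h\<in>P. \<not> cst (al h) I) \<Longrightarrow>
     (\<forall>x\<in>simplex I n y. \<forall>r\<in>I. \<forall>s\<in>I. r \<noteq> s \<longrightarrow> deficit U al ka P \<kappa> r s x \<le> \<epsilon>) \<Longrightarrow>
     q * n \<le> card P + 2 * \<epsilon> + K"
    using assms unfolding corner_def by metis
  show ?thesis unfolding lower_slope_def
  proof (intro exI[of _ "real K"] conjI allI impI)
    fix U I P :: "nat set" and al :: "nat \<Rightarrow> nat \<Rightarrow> real" and ka y n
    assume a: "covers D \<kappa> U I P al ka y n"
    then have f: "finite U" "I \<subseteq> U" "card I = D" "finite P" "\<forall>h\<in>P. \<not> cst (al h) I"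
      and c: "\<And>x. x \<in> simplex I n y \<Longrightarrow> \<kappa> \<le> cov U al ka P x" unfolding covers_def by blast+
    have "deficit U al ka P \<kappa> r s x \<le> 0" if "x \<in> simplex I n y" "r \<in> I" "s \<in> I" "r \<noteq> s" for x r s
    proof -
      have "finite I" using f finite_subset by blast
      then have "\<kappa> \<le> cov U al ka P (x(r := t, s := x r + x s - t))" if "t \<le> x r + x s" for t
        using c simplex_line \<open>x \<in> _\<close> \<open>r \<in> I\<close> \<open>s \<in> I\<close> \<open>r \<noteq> s\<close> that by blast
      then show ?thesis unfolding deficit_def by simp
    qed
    then have "q * n \<le> card P + 2 * 0 + K" by (intro K[OF f]) blast
    then have "q * n \<le> card P + K" by simp
    then show "real q * real n \<le> real (card P) + real K" by (metis of_nat_add of_nat_le_iff of_nat_mult)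
  qed simp
qed

locale cover_family =
  fixes D \<kappa> U I P al ka y n
  assumes cf: "covers D \<kappa> U I P al ka y n"
begin

text \<open>As the sum over \<open>I\<close> is fixed, a form that is constant on
  \<open>I - {i}\<close> is an affine function of \<open>x i\<close>. These are the planes parallel
  to the facet \<open>x i = 0\<close>, and \<open>W i t\<close> collects those lying at level
  \<open>t\<close>.\<close>

definition "S i = {h\<in>P. cst (al h) (I - {i})}"
definition "W i t = {h \<in> S i. \<exists>x\<in>simplex I n y. x i = t \<and> ev U (al h) x = ka h}"

lemma cD: "finite U" "I \<subseteq> U" "card I = D" "finite P" "\<And>h. h \<in> P \<Longrightarrow> \<not> cst (al h) I"
    "\<And>x. x \<in> simplex I n y \<Longrightarrow> \<kappa> \<le> cov U al ka P x"
  using cf unfolding covers_def by blast+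

lemma fI: "finite I" using cD finite_subset by blast

lemma finS: "finite (S i)" "finite (W i t)" using cD(4) by (auto simp: S_def W_def)

lemma SP: "S i \<subseteq> P" by (auto simp: S_def)

lemma ev_slice:
  assumes x: "x \<in> simplex I n y" and c: "cst f (I - {i})" and ij: "i \<in> I" "j \<in> I" "i \<noteq> j"
  shows "ev U f x = ev U f (\<lambda>l. if l \<in> I then 0 else y l) + f i * real (x i) + f j * real (n - x i)"
proof -
  let ?z = "\<lambda>l. if l \<in> I then 0 else y l"
  let ?w = "?z(i := x i, j := n - x i)"
  have s: "n = x i + sum x (I - {i})"
    using x fI ij unfolding simplex_def by (simp add: sum.remove[of I i])
  have "ev U f x = ev U f ?w"
  proof (rule ev_const[OF cD(1) _ c])
    show "I - {i} \<subseteq> U" using cD by blast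
    have o: "x l = y l" if "l \<notin> I" for l using x that unfolding simplex_def by blast
    show "x l = ?w l" if "l \<notin> I - {i}" for l
    proof (cases "l = i")
      case False
      then have "l \<notin> I" "l \<noteq> j" using that ij by auto
      then show ?thesis using o False by simp
    qed (use ij in simp)
    have "sum ?w (I - {i}) = ?w j + sum ?w (I - {i} - {j})"
      by (rule sum.remove) (use fI ij in auto)
    moreover have "sum ?w (I - {i} - {j}) = 0" by (rule sum.neutral) auto
    moreover have "?w j = n - x i" by simp
    ultimately show "sum x (I - {i}) = sum ?w (I - {i})" using s by linarith
  qed
  also have "\<dots> = ev U f ?z + f i * real (x i) + f j * real (n - x i)"
    using ij cD(1,2) by (subst ev_upd, simp, blast, subst ev_upd) auto
  finally show ?thesis .
qed

lemma W_disjoint: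
  assumes "i \<in> I" "2 \<le> D" "h \<in> W i t" "h \<in> W i t'"
  shows "t = t'"
proof (rule ccontr)
  assume ne: "t \<noteq> t'"
  obtain j where j: "j \<in> I" "i \<noteq> j"
  proof -
    have "\<not> I \<subseteq> {i}" using assms(2) cD(3) card_mono[of "{i}" I] by auto
    then show ?thesis using that by blast
  qed
  from assms(3) obtain x where x: "x \<in> simplex I n y" "x i = t" "ev U (al h) x = ka h" and h: "h \<in> S i"
    unfolding W_def by blast
  from assms(4) obtain x' where x': "x' \<in> simplex I n y" "x' i = t'" "ev U (al h) x' = ka h"
    unfolding W_def by blast
  have c: "cst (al h) (I - {i})" "h \<in> P" using h by (auto simp: S_def)
  have le: "w i \<le> n" if "w \<in> simplex I n y" for w
  proof -
    have "w i \<le> sum w I" by (rule member_le_sum) (use fI assms(1) in auto)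
    then show ?thesis using that by (simp add: simplex_def)
  qed
  have "(al h i - al h j) * real t = (al h i - al h j) * real t'"
    using ev_slice[OF x(1) c(1) assms(1) j] ev_slice[OF x'(1) c(1) assms(1) j] x x' le[OF x(1)] le[OF x'(1)]
    by (simp add: of_nat_diff algebra_simps)
  then have "al h i = al h j" using ne by simp
  moreover have "al h l = al h j" if "l \<in> I - {i}" for l using cstD[OF c(1) that, of j] j by blast
  ultimately have "al h l = al h j" if "l \<in> I" for l using that by blast
  then have "cst (al h) I" unfolding cst_def by metis
  then show False using cD(5) c(2) by blast
qed

text \<open>A third coordinate links the two constancy conditions. With two coordinates every plane
  would lie in both sets.\<close>

lemma S_disjoint:
  assumes "i \<in> I" "j \<in> I" "i \<noteq> j" "3 \<le> D"
  shows "S i \<inter> S j = {}"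
proof -
  have "\<not> I \<subseteq> {i,j}" using assms cD(3) card_mono[of "{i,j}" I] by auto
  then obtain l where l: "l \<in> I" "l \<noteq> i" "l \<noteq> j" by blast
  have False if h: "h \<in> S i" "h \<in> S j" for h
  proof -
    have c: "cst (al h) (I - {i})" "cst (al h) (I - {j})" "h \<in> P" using h by (auto simp: S_def)
    have "al h m = al h l" if "m \<in> I" for m
    proof (cases "m = i")
      case True then show ?thesis using cstD[OF c(2), of m l] l assms by blast
    next
      case False then show ?thesis using cstD[OF c(1), of m l] l that by blast
    qed
    then have "cst (al h) I" unfolding cst_def by metis
    then show False using cD(5) c(3) by blast
  qed
  then show ?thesis by blast
qed

lemma S_total:
  assumes "3 \<le> D"
  shows "(\<Sum>i\<in>I. card (S i)) \<le> card P"
proof -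
  have "card (\<Union>i\<in>I. S i) = (\<Sum>i\<in>I. card (S i))"
    by (rule card_UN_disjoint) (use fI finS S_disjoint assms in auto)
  moreover have "card (\<Union>i\<in>I. S i) \<le> card P" by (rule card_mono[OF cD(4)]) (use SP in blast)
  ultimately show ?thesis by simp
qed

text \<open>Take the first level with at most one plane and the first level with none. Levels below
  \<open>a\<close> carry at least two planes and the others below \<open>b\<close> at least one,
  which makes \<open>a + b\<close> in total.\<close>

lemma sparse_slices:
  assumes "i \<in> I" "2 \<le> D"
  obtains a b where "card (W i a) \<le> 1" "card (W i b) = 0" "a + b \<le> card (S i)"
proof -
  have "W i (Suc n) = {}"
  proof -
    have "x i \<le> n" if "x \<in> simplex I n y" for x
      using that member_le_sum[of i I x] fI assms(1) by (simp add: simplex_def)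
    then show ?thesis unfolding W_def by force
  qed
  then have ex: "\<exists>t. card (W i t) \<le> e" for e by (metis card.empty le0)
  define a where "a = (LEAST t. card (W i t) \<le> 1)"
  define b where "b = (LEAST t. card (W i t) \<le> 0)"
  have a: "card (W i a) \<le> 1" unfolding a_def by (rule LeastI_ex[OF ex])
  have b: "card (W i b) \<le> 0" unfolding b_def by (rule LeastI_ex[OF ex])
  have na: "\<not> card (W i t) \<le> 1" if "t < a" for t using that unfolding a_def by (rule not_less_Least)
  have nb: "\<not> card (W i t) \<le> 0" if "t < b" for t using that unfolding b_def by (rule not_less_Least)
  have ab: "a \<le> b" unfolding a_def by (rule Least_le) (use b in simp)
  have "a + b = (\<Sum>t<b. 1) + (\<Sum>t<a. 1)" by simp
  also have "(\<Sum>t<a. 1::nat) = (\<Sum>t<b. if t < a then 1 else 0)"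
    using ab by (intro sum.mono_neutral_cong_left) auto
  also have "(\<Sum>t<b. 1) + (\<Sum>t<b. if t < a then 1 else 0::nat) = (\<Sum>t<b. 1 + (if t < a then 1 else 0))"
    by (simp only: sum.distrib)
  also have "\<dots> \<le> (\<Sum>t<b. card (W i t))"
  proof (rule sum_mono)
    fix t assume "t \<in> {..<b}"
    then show "1 + (if t < a then 1 else 0) \<le> card (W i t)" using na[of t] nb[of t] by auto
  qed
  also have "\<dots> = card (\<Union>t<b. W i t)"
    by (rule card_UN_disjoint[symmetric]) (use finS W_disjoint[OF assms] in auto)
  also have "\<dots> \<le> card (S i)" by (rule card_mono) (use finS in \<open>auto simp: W_def\<close>)
  finally show ?thesis using that a b by blast
qed

text \<open>On the slice \<open>x i = t\<close> the planes of \<open>S i\<close> contribute at most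
  \<open>e\<close>. All others are not constant on \<open>I - {i}\<close> and so form a cover with
  one coordinate less; the planes of \<open>S i\<close> come on top.\<close>

lemma slice_bound:
  assumes i: "i \<in> I" and D: "D = Suc D'" and e: "card (W i t) \<le> e" and c: "0 \<le> c" "0 \<le> K"
    and K: "\<And>U I P al ka y n. covers D' (\<kappa> - e) U I P al ka y n \<Longrightarrow> c * real n \<le> real (card P) + K"
  shows "real (card (S i)) + c * (real n - real t) \<le> real (card P) + K"
proof -
  have cd: "real (card (P - S i)) + real (card (S i)) = real (card P)"
  proof -
    have "card (P - S i) = card P - card (S i)" by (rule card_Diff_subset) (use finS SP in auto)
    moreover have "card (S i) \<le> card P" by (rule card_mono) (use cD SP in auto)
    ultimately show ?thesis by simp
  qed
  have "c * (real n - real t) \<le> real (card (P - S i)) + K"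
  proof (cases "t \<le> n")
    case True
    have "covers D' (\<kappa> - e) U (I - {i}) (P - S i) al ka (y(i := t)) (n - t)"
      unfolding covers_def
    proof (intro conjI ballI)
      show "finite U" "I - {i} \<subseteq> U" "finite (P - S i)" using cD by auto
      show "card (I - {i}) = D'" using cD(3) D i fI by simp
      show "\<not> cst (al h) (I - {i})" if "h \<in> P - S i" for h using that by (auto simp: S_def)
      fix x assume x: "x \<in> simplex (I - {i}) (n - t) (y(i := t))"
      then have xt: "x i = t" by (auto simp: simplex_def)
      have "sum x I = x i + sum x (I - {i})" by (rule sum.remove) (use fI i in auto)
      then have xI: "x \<in> simplex I n y" using x xt True i by (auto simp: simplex_def)
      have "\<kappa> \<le> cov U al ka P x" by (rule cD(6)[OF xI])
      also have "\<dots> = card {h\<in>P. ev U (al h) x = ka h \<and> h \<in> S i} + card {h\<in>P. ev U (al h) x = ka h \<and> h \<notin> S i}"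
        unfolding cov_def by (rule card_split[OF cD(4)])
      also have "{h\<in>P. ev U (al h) x = ka h \<and> h \<notin> S i} = {h\<in>P - S i. ev U (al h) x = ka h}" by blast
      also have "card {h\<in>P. ev U (al h) x = ka h \<and> h \<in> S i} \<le> card (W i t)"
        by (rule card_mono) (use finS xI xt in \<open>auto simp: W_def\<close>)
      finally show "\<kappa> - e \<le> cov U al ka (P - S i) x" using e unfolding cov_def by linarith
    qed
    then show ?thesis using K True by (metis of_nat_diff)
  next
    \<comment> \<open>The level may lie beyond the simplex, since a level without planes is only
      guaranteed at \<open>n + 1\<close>. The claim is then trivial.\<close>
    case False
    then have "c * (real n - real t) \<le> 0" using c by (simp add: mult_nonneg_nonpos)
    then show ?thesis using c by linarith
  qed
  then show ?thesis using cd by linarith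
qed

end

text \<open>The threshold \<open>n / s\<close> is the share of one coordinate in the target
  \<open>(D + 1) * n / s\<close>. If every \<open>S i\<close> reaches it, the sum suffices.
  Otherwise the slice at \<open>b\<close> gives \<open>c * n - (c - 1) * card (S i)\<close>, which
  decreases in \<open>card (S i)\<close> and equals the target at the threshold.\<close>

lemma lower_slope_above:
  assumes "2 \<le> \<kappa>" "2 * \<kappa> - 2 \<le> D"
  shows "lower_slope D \<kappa> (real D / (real D + 1 - real \<kappa>))"
  using assms(2)
proof (induction D rule: dec_induct)
  case base
  define r where "r = \<kappa> - 1"
  have r: "\<kappa> = r + 1" "1 \<le> r" using assms(1) by (auto simp: r_def)
  have "2 * \<kappa> - 2 = 2 * r" using r by simp
  moreover have "real (2 * r) / (real (2 * r) + 1 - real \<kappa>) = real 2" using r by (simp add: field_simps)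
  ultimately show ?case using corner_lower_slope[OF corner_two[OF r(2)]] r(1) by metis
next
  case (step D)
  define c where "c = real D / (real D + 1 - real \<kappa>)"
  define s where "s = real D + 2 - real \<kappa>"
  have kD: "\<kappa> \<le> D" "2 \<le> D" using step assms(1) by auto
  then have s: "s \<ge> 2" "c = real D / (s - 1)" "c \<ge> 1" using assms(1) by (auto simp: s_def c_def field_simps)
  have cs: "c * (s - 1) = real D" using s by simp
  obtain K where K: "K \<ge> 0" "\<And>U I P al ka y n. covers D \<kappa> U I P al ka y n \<Longrightarrow> c * real n \<le> real (card P) + K"
    using step.IH unfolding lower_slope_def c_def by blast
  show ?case unfolding lower_slope_def
  proof (intro exI[of _ K] conjI allI impI)
    fix U I P :: "nat set" and al :: "nat \<Rightarrow> nat \<Rightarrow> real" and ka y n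
    assume "covers (Suc D) \<kappa> U I P al ka y n"
    then interpret cover_family "Suc D" \<kappa> U I P al ka y n by unfold_locales
    have goal: "real (Suc D) * real n \<le> s * (real (card P) + K)"
    proof (cases "\<exists>i\<in>I. s * real (card (S i)) < real n")
      case True
      then obtain i where i: "i \<in> I" "s * real (card (S i)) < real n" by blast
      have "2 \<le> Suc D" using kD by simp
      then obtain a b where ab: "card (W i b) = 0" "a + b \<le> card (S i)"
        using sparse_slices[OF i(1)] by blast
      have "real (card (S i)) + c * (real n - real b) \<le> real (card P) + K"
        by (rule slice_bound[OF i(1) refl, of b 0]) (use ab s K in auto)
      moreover have "c * (real n - real b) \<ge> c * (real n - real (card (S i)))"
        using ab(2) s by (intro mult_left_mono) auto
      ultimately have "real (card (S i)) + c * (real n - real (card (S i))) \<le> real (card P) + K" by linarith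
      then have "s * (real (card (S i)) + c * (real n - real (card (S i)))) \<le> s * (real (card P) + K)"
        using s by (intro mult_left_mono) auto
      moreover have "s * (real (card (S i)) + c * (real n - real (card (S i))))
          = s * c * real n - (c - 1) * (s * real (card (S i)))" by (simp add: algebra_simps)
      moreover have "(c - 1) * (s * real (card (S i))) \<le> (c - 1) * real n"
        using i s by (intro mult_left_mono) auto
      moreover have "s * c * real n - (c - 1) * real n = (c * (s - 1) + 1) * real n" by (simp add: algebra_simps)
      ultimately show ?thesis using cs by (simp add: add.commute)
    next
      case False
      then have "(\<Sum>i\<in>I. real n) \<le> (\<Sum>i\<in>I. s * real (card (S i)))" by (intro sum_mono) (auto simp: not_less)
      also have "\<dots> = s * real (\<Sum>i\<in>I. card (S i))" by (simp add: sum_distrib_left)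
      also have "\<dots> \<le> s * (real (card P) + K)"
      proof (rule mult_left_mono)
        have "(\<Sum>i\<in>I. card (S i)) \<le> card P" by (rule S_total) (use kD in simp)
        then show "real (\<Sum>i\<in>I. card (S i)) \<le> real (card P) + K" using K(1) by linarith
      qed (use s in simp)
      finally show ?thesis using cD(3) by simp
    qed
    have "real (Suc D) + 1 - real \<kappa> = s" by (simp add: s_def)
    then show "real (Suc D) / (real (Suc D) + 1 - real \<kappa>) * real n \<le> real (card P) + K"
      using goal s by (simp add: pos_divide_le_eq mult.commute)
  qed (use K in simp)
qed

text \<open>The ends of the range are the two corner cases. In between, both
  \<open>(D, \<kappa> - 1)\<close> and \<open>(D, \<kappa>)\<close> are again in range: the slice at
  \<open>a\<close> keeps the demand \<open>\<kappa> - 1\<close> and the slice at \<open>b\<close>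
  keeps \<open>\<kappa>\<close>. The threshold \<open>3 * n / M\<close> is the share of one
  coordinate in the target.\<close>

lemma lower_slope_below:
  assumes "2 \<le> \<kappa>" "2 \<le> D" "\<kappa> \<le> D + 1" "D \<le> 2 * \<kappa> - 2"
  shows "lower_slope D \<kappa> (3 * real D / (2 * real D + 1 - real \<kappa>))"
  using assms
proof (induction D arbitrary: \<kappa>)
  case (Suc D)
  consider "\<kappa> = Suc D + 1" | "Suc D = 2 * \<kappa> - 2" | "\<kappa> \<le> Suc D" "Suc D + 3 \<le> 2 * \<kappa>" using Suc.prems by linarith
  then show ?case
  proof cases
    case 1
    have "3 * real (Suc D) / (2 * real (Suc D) + 1 - real \<kappa>) = real 3" using 1 by (simp add: field_simps)
    then show ?thesis using corner_lower_slope[OF corner_three[of "Suc D"]] 1 Suc.prems(2) by metis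
  next
    case 2
    define r where "r = \<kappa> - 1"
    have r: "\<kappa> = r + 1" "1 \<le> r" using Suc.prems by (auto simp: r_def)
    have D: "Suc D = 2 * r" using 2 r by simp
    have "3 * real (2 * r) / (2 * real (2 * r) + 1 - real \<kappa>) = real 2" using r by (simp add: field_simps)
    then show ?thesis using corner_lower_slope[OF corner_two[OF r(2)]] r(1) D by metis
  next
    case 3
    define M where "M = 2 * real D + 3 - real \<kappa>"
    have nat: "2 \<le> D" "3 \<le> \<kappa>" "\<kappa> \<le> D + 1" "D + 4 \<le> 2 * \<kappa>" using 3 Suc.prems by linarith+
    have M: "M \<ge> 4" using nat by (simp add: M_def)
    \<comment> \<open>This is the sign that allows \<open>M * s\<close> to be replaced by its upper
      bound \<open>3 * real n\<close> in the final combination.\<close>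
    have M3: "2 * M - 3 \<le> 3 * real D" using nat by (simp add: M_def)
    have "lower_slope D (\<kappa> - 1) (3 * real D / (2 * real D + 1 - real (\<kappa> - 1)))"
      by (rule Suc.IH) (use nat in auto)
    moreover have "2 * real D + 1 - real (\<kappa> - 1) = M - 1" using nat by (simp add: M_def of_nat_diff)
    ultimately have l1: "lower_slope D (\<kappa> - 1) (3 * real D / (M - 1))" by (simp only:)
    have "lower_slope D \<kappa> (3 * real D / (2 * real D + 1 - real \<kappa>))"
      by (rule Suc.IH) (use nat in auto)
    moreover have "2 * real D + 1 - real \<kappa> = M - 2" by (simp add: M_def)
    ultimately have l2: "lower_slope D \<kappa> (3 * real D / (M - 2))" by (simp only:)
    define c1 where "c1 = 3 * real D / (M - 1)"
    define c2 where "c2 = 3 * real D / (M - 2)"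
    have c: "c1 \<ge> 0" "c2 \<ge> 0" "c1 * (M - 1) = 3 * real D" "c2 * (M - 2) = 3 * real D"
      using M by (auto simp: c1_def c2_def)
    obtain K1 where K1: "K1 \<ge> 0" "\<And>U I P al ka y n. covers D (\<kappa> - 1) U I P al ka y n \<Longrightarrow> c1 * real n \<le> real (card P) + K1"
      using l1 unfolding lower_slope_def c1_def by blast
    obtain K2 where K2: "K2 \<ge> 0" "\<And>U I P al ka y n. covers D \<kappa> U I P al ka y n \<Longrightarrow> c2 * real n \<le> real (card P) + K2"
      using l2 unfolding lower_slope_def c2_def by blast
    define K where "K = max K1 K2"
    show ?thesis unfolding lower_slope_def
    proof (intro exI[of _ K] conjI allI impI)
      fix U I P :: "nat set" and al :: "nat \<Rightarrow> nat \<Rightarrow> real" and ka y n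
      assume "covers (Suc D) \<kappa> U I P al ka y n"
      then interpret cover_family "Suc D" \<kappa> U I P al ka y n by unfold_locales
      define N where "N = real (card P) + K"
      have goal: "3 * real (Suc D) * real n \<le> M * N"
      proof (cases "\<exists>i\<in>I. M * real (card (S i)) < 3 * real n")
        case True
        then obtain i where i: "i \<in> I" "M * real (card (S i)) < 3 * real n" by blast
        have "2 \<le> Suc D" using nat by simp
        then obtain a b where ab: "card (W i a) \<le> 1" "card (W i b) = 0" "a + b \<le> card (S i)"
          using sparse_slices[OF i(1)] by blast
        define s where "s = real (card (S i))"
        have "s + c1 * (real n - real a) \<le> real (card P) + K1"
          unfolding s_def by (rule slice_bound[OF i(1) refl ab(1) c(1) K1])
        then have 1: "c1 * (real n - real a) \<le> N - s" unfolding N_def K_def by linarith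
        have "s + c2 * (real n - real b) \<le> real (card P) + K2"
          unfolding s_def by (rule slice_bound[OF i(1) refl, of b 0]) (use ab c K2 in auto)
        then have 2: "c2 * (real n - real b) \<le> N - s" unfolding N_def K_def by linarith
        \<comment> \<open>The weights \<open>M - 1\<close> and \<open>M - 2\<close> give \<open>a\<close> and \<open>b\<close> the same coefficient, so that \<open>a + b \<le> s\<close> applies.\<close>
        have "(M - 1) * (c1 * (real n - real a)) \<le> (M - 1) * (N - s)"
          using 1 M by (intro mult_left_mono) auto
        moreover have "(M - 1) * (c1 * (real n - real a)) = 3 * real D * (real n - real a)"
          using c(3) by (metis mult.assoc mult.commute)
        moreover have "(M - 2) * (c2 * (real n - real b)) \<le> (M - 2) * (N - s)"
          using 2 M by (intro mult_left_mono) auto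
        moreover have "(M - 2) * (c2 * (real n - real b)) = 3 * real D * (real n - real b)"
          using c(4) by (metis mult.assoc mult.commute)
        moreover have "3 * real D * (real n - real a) + 3 * real D * (real n - real b)
            = 3 * real D * (2 * real n - real (a + b))" by (simp add: algebra_simps)
        moreover have "3 * real D * (2 * real n - s) \<le> 3 * real D * (2 * real n - real (a + b))"
          using ab(3) by (intro mult_left_mono) (auto simp: s_def)
        moreover have "(M - 1) * (N - s) + (M - 2) * (N - s) = (2 * M - 3) * (N - s)" by (simp add: algebra_simps)
        ultimately have "3 * real D * (2 * real n - s) \<le> (2 * M - 3) * (N - s)" by linarith
        then have "M * (3 * real D * (2 * real n - s)) \<le> M * ((2 * M - 3) * (N - s))"
          using M by (intro mult_left_mono) auto
        moreover have "(3 * real D - (2 * M - 3)) * (M * s) \<le> (3 * real D - (2 * M - 3)) * (3 * real n)"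
          using i(2) M3 by (intro mult_left_mono) (auto simp: s_def)
        moreover have "M * (3 * real D * (2 * real n - s)) - M * ((2 * M - 3) * (N - s))
            + (3 * real D - (2 * M - 3)) * (M * s) - (3 * real D - (2 * M - 3)) * (3 * real n)
            = (2 * M - 3) * (3 * real (Suc D) * real n - M * N)"
          by (simp add: algebra_simps)
        ultimately have "(2 * M - 3) * (3 * real (Suc D) * real n - M * N) \<le> 0" by linarith
        then show ?thesis using M by (simp add: mult_le_0_iff)
      next
        case False
        then have "(\<Sum>i\<in>I. 3 * real n) \<le> (\<Sum>i\<in>I. M * real (card (S i)))" by (intro sum_mono) (auto simp: not_less)
        also have "\<dots> = M * real (\<Sum>i\<in>I. card (S i))" by (simp add: sum_distrib_left)
        also have "\<dots> \<le> M * N"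
        proof (rule mult_left_mono)
          have "(\<Sum>i\<in>I. card (S i)) \<le> card P" by (rule S_total) (use nat in simp)
          then show "real (\<Sum>i\<in>I. card (S i)) \<le> N" using K1(1) unfolding N_def K_def by linarith
        qed (use M in simp)
        finally have "(\<Sum>i\<in>I. 3 * real n) \<le> M * N" .
        moreover have "(\<Sum>i\<in>I. 3 * real n) = 3 * real (Suc D) * real n"
          unfolding sum_constant cD(3) by simp
        ultimately show ?thesis by linarith
      qed
      have "2 * real (Suc D) + 1 - real \<kappa> = M" by (simp add: M_def)
      then show "3 * real (Suc D) / (2 * real (Suc D) + 1 - real \<kappa>) * real n \<le> real (card P) + K"
        using goal M unfolding N_def by (simp add: pos_divide_le_eq mult.commute)
    qed (use K1 in \<open>simp add: K_def\<close>)
  qed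
qed simp

section \<open>Back to hyperplanes: the lower bound and the explicit covers\<close>

lemma kcover_covers:
  assumes H: "is_kcover n d k H" and n: "1 \<le> n"
  shows "\<exists>al ka. covers (Suc d) k {..d} {..d} {..<size H} al ka (\<lambda>_. 0) (n - 1)"
proof -
  obtain hs where hs: "H = mset hs" by (metis ex_mset)
  define Q where "Q h a b \<longleftrightarrow> (\<exists>i<d. a i \<noteq> 0) \<and> h = {x \<in> Rd d. (\<Sum>i<d. a i * x i) = b}"
    for h and a :: "nat \<Rightarrow> real" and b
  have "\<exists>a b. Q (hs ! j) a b" if "j < length hs" for j
  proof -
    have "hs ! j \<in> affine_hyperplanes d" using H hs that unfolding is_kcover_def by auto
    then show ?thesis unfolding affine_hyperplanes_def Q_def by blast
  qed
  then obtain a b where "\<And>j. j < length hs \<Longrightarrow> Q (hs ! j) (a j) (b j)" by metis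
  then have ab: "\<And>j. j < length hs \<Longrightarrow> \<exists>i<d. a j i \<noteq> 0"
    "\<And>j. j < length hs \<Longrightarrow> hs ! j = {x \<in> Rd d. (\<Sum>i<d. a j i * x i) = b j}" unfolding Q_def by blast+
  \<comment> \<open>The slack coordinate \<open>d\<close> gets coefficient 0. Some other coefficient
    is nonzero, so the extended form is not constant.\<close>
  define al where "al j i = (if i < d then a j i else 0)" for j i
  have "covers (Suc d) k {..d} {..d} {..<size H} al b (\<lambda>_. 0) (n - 1)"
    unfolding covers_def
  proof (intro conjI ballI)
    fix j assume "j \<in> {..<size H}"
    then obtain i where i: "i < d" "a j i \<noteq> 0" using ab(1) hs by auto
    show "\<not> cst (al j) {..d}"
    proof
      assume "cst (al j) {..d}"
      then have "al j i = al j d" by (rule cstD) (use i in auto)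
      then show False using i by (simp add: al_def)
    qed
  next
    fix x assume x: "x \<in> simplex {..d} (n - 1) (\<lambda>_. 0)"
    define p where "p i = real (if i < d then x i else 0)" for i
    have "p = (\<lambda>i. real (if i < d then x i else 0))" by (simp add: p_def fun_eq_iff)
    moreover have "(\<Sum>i<d. if i < d then x i else 0) + 1 \<le> n"
    proof -
      have "(\<Sum>i<d. if i < d then x i else 0) = (\<Sum>i<d. x i)" by (rule sum.cong) auto
      moreover have "(\<Sum>i<d. x i) \<le> (\<Sum>i\<le>d. x i)" by (rule sum_mono2) auto
      ultimately show ?thesis using x n unfolding simplex_def by simp
    qed
    ultimately have "p \<in> Tset d n" unfolding Tset_def by auto
    then have "k \<le> size (filter_mset (\<lambda>h. p \<in> h) H)" using H unfolding is_kcover_def by blast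
    also have "\<dots> = length (filter (\<lambda>h. p \<in> h) hs)" by (simp add: hs flip: mset_filter)
    also have "\<dots> = card {j. j < length hs \<and> p \<in> hs ! j}" by (rule length_filter_conv_card)
    also have "{j. j < length hs \<and> p \<in> hs ! j} = {j \<in> {..<size H}. ev {..d} (al j) x = b j}"
    proof -
      have "p \<in> hs ! j \<longleftrightarrow> ev {..d} (al j) x = b j" if "j < length hs" for j
      proof -
        have "p \<in> Rd d" by (simp add: Rd_def p_def)
        moreover have "ev {..d} (al j) x = (\<Sum>i<d. a j i * p i)"
          by (simp add: ev_def al_def p_def lessThan_Suc_atMost[symmetric])
        ultimately show ?thesis using ab(2)[OF that] by simp
      qed
      then show ?thesis by (auto simp: hs)
    qed
    finally show "k \<le> cov {..d} al b {..<size H} x" unfolding cov_def .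
  qed auto
  then show ?thesis by blast
qed

lemma kcover_size_lower:
  assumes "lower_slope (Suc d) k c"
  shows "\<exists>K. \<forall>n\<ge>1. \<forall>H. is_kcover n d k H \<longrightarrow> c * real n - K \<le> real (size H)"
proof -
  obtain K where K: "\<And>U I P al ka y n. covers (Suc d) k U I P al ka y n \<Longrightarrow> c * real n \<le> real (card P) + K"
    using assms unfolding lower_slope_def by blast
  show ?thesis
  proof (intro exI[of _ "K + c"] allI impI)
    fix n H assume "1 \<le> n" "is_kcover n d k H"
    then obtain al ka where "covers (Suc d) k {..d} {..d} {..<size H} al ka (\<lambda>_. 0) (n - 1)"
      using kcover_covers by blast
    then have "c * real (n - 1) \<le> real (size H) + K" using K by fastforce
    then show "c * real n - (K + c) \<le> real (size H)" using \<open>1 \<le> n\<close> by (simp add: of_nat_diff algebra_simps)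
  qed
qed

text \<open>The hyperplane \<open>x i = c\<close>, where \<open>x d\<close> is the slack coordinate, is taken \<open>s - c div m\<close> times.\<close>

lemma kcover_exists:
  assumes d: "1 \<le> d" and n: "1 \<le> n" and k: "k + M = s * Suc d + 1" "1 \<le> M"
  shows "\<exists>H. is_kcover n d k H \<and> size H = Suc d * ((\<Sum>r<s. s - r) * Suc ((n - 1) div M))"
proof -
  \<comment> \<open>The smallest natural number with \<open>n - 1 < m * M\<close>. It makes the sum
    of all \<open>x i div m\<close> smaller than \<open>M\<close>.\<close>
  define m where "m = Suc ((n - 1) div M)"
  \<comment> \<open>For \<open>i = d\<close> the condition that the slack equals \<open>c\<close> is
    written in the first \<open>d\<close> coordinates. The index \<open>r\<close> only produces
    copies.\<close>
  define hyp where "hyp = (\<lambda>(i, r :: nat, c). {x \<in> Rd d. (\<Sum>j<d. (if i = d \<or> i = j then 1 else 0) * x j) =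
      (if i = d then real (n - 1) - real c else real c)})"
  \<comment> \<open>The value \<open>c\<close> is listed for each \<open>r\<close> with
    \<open>c < (s - r) * m\<close>, hence \<open>s - c div m\<close> times.\<close>
  define A where "A = Sigma {..d} (\<lambda>_. Sigma {..<s} (\<lambda>r. {..<(s - r) * m}))"
  define H where "H = image_mset hyp (mset_set A)"
  have fA: "finite A" by (simp add: A_def)
  have "size H = card A" by (simp add: H_def)
  also have "\<dots> = Suc d * ((\<Sum>r<s. s - r) * m)" by (simp add: A_def sum_distrib_right)
  finally have sz: "size H = Suc d * ((\<Sum>r<s. s - r) * m)" .
  have "is_kcover n d k H" unfolding is_kcover_def
  proof (intro conjI ballI subsetI)
    fix h assume "h \<in> set_mset H"
    then obtain i r c where i: "i \<le> d" and h: "h = hyp (i, r, c)" by (auto simp: H_def fA A_def)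
    let ?a = "\<lambda>j. if i = d \<or> i = j then 1 else 0 :: real"
    have "\<exists>j<d. ?a j \<noteq> 0"
    proof (cases "i = d")
      case True then show ?thesis using d by (intro exI[of _ 0]) simp
    next
      case False then show ?thesis using i by (intro exI[of _ i]) simp
    qed
    then show "h \<in> affine_hyperplanes d" unfolding h hyp_def affine_hyperplanes_def prod.case mem_Collect_eq
      by (intro exI[of _ ?a] exI[of _ "if i = d then real (n - 1) - real c else real c"] conjI refl)
  next
    fix p assume "p \<in> Tset d n"
    then obtain y where p: "p = (\<lambda>i. real (y i))" and y: "\<And>i. d \<le> i \<Longrightarrow> y i = 0" "(\<Sum>i<d. y i) + 1 \<le> n"
      unfolding Tset_def by blast
    define x where "x i = (if i = d then n - 1 - (\<Sum>j<d. y j) else y i)" for i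
    have sx: "(\<Sum>i\<le>d. x i) = n - 1"
    proof -
      have "(\<Sum>i<d. x i) = (\<Sum>i<d. y i)" by (rule sum.cong) (auto simp: x_def)
      moreover have "(\<Sum>i\<le>d. x i) = (\<Sum>i<d. x i) + x d" by (simp add: lessThan_Suc_atMost[symmetric])
      ultimately show ?thesis using y(2) by (simp add: x_def)
    qed
    have hit: "p \<in> hyp (i, r, x i)" if "i \<le> d" for i r
    proof (cases "i = d")
      case True
      have le: "(\<Sum>j<d. y j) \<le> n - 1" using y(2) by simp
      have xd: "x d = n - 1 - (\<Sum>j<d. y j)" by (simp add: x_def)
      have "real (n - 1) - real (x d) = real (\<Sum>j<d. y j)" unfolding xd of_nat_diff[OF le] by simp
      then show ?thesis using True y(1) by (simp add: hyp_def Rd_def p)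
    next
      case False
      then have "(\<Sum>j<d. (if i = d \<or> i = j then 1 else 0) * p j) = p i" using that by (simp add: if_distrib[of "\<lambda>u. u * _"] cong: if_cong)
      then show ?thesis using False y(1) by (simp add: hyp_def Rd_def p x_def)
    qed
    have div: "m * (\<Sum>i\<le>d. x i div m) < m * M"
    proof -
      have "m * (\<Sum>i\<le>d. x i div m) \<le> (\<Sum>i\<le>d. x i)" unfolding sum_distrib_left by (rule sum_mono) simp
      also have "\<dots> < m * M"
        unfolding sx m_def using k(2) dividend_less_div_times[of M "n - 1"] by simp
      finally show ?thesis .
    qed
    then have "(\<Sum>i\<le>d. x i div m) < M" by simp
    moreover have "(\<Sum>i\<le>d. s) \<le> (\<Sum>i\<le>d. (s - x i div m) + x i div m)" by (rule sum_mono) simp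
    then have "s * Suc d \<le> (\<Sum>i\<le>d. s - x i div m) + (\<Sum>i\<le>d. x i div m)" by (simp add: sum.distrib mult.commute)
    ultimately have "k \<le> (\<Sum>i\<le>d. s - x i div m)" using k(1) by linarith
    also have "\<dots> = card (Sigma {..d} (\<lambda>i. {..<s - x i div m}))" by simp
    also have "\<dots> \<le> card {t \<in> A. p \<in> hyp t}"
    proof (rule card_inj_on_le[of "\<lambda>(i, r). (i, r, x i)"])
      have "x i < (s - r) * m" if "r < s - x i div m" for i r
      proof -
        have "x i div m < s - r" using that by linarith
        then show ?thesis by (simp add: m_def div_less_iff_less_mult)
      qed
      then show "(\<lambda>(i, r). (i, r, x i)) ` Sigma {..d} (\<lambda>i. {..<s - x i div m}) \<subseteq> {t \<in> A. p \<in> hyp t}"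
        using hit unfolding A_def by fastforce
    qed (use fA in \<open>auto simp: inj_on_def\<close>)
    also have "\<dots> = size (filter_mset (\<lambda>h. p \<in> h) H)"
      using fA by (simp add: H_def filter_mset_image_mset)
    finally show "k \<le> size (filter_mset (\<lambda>h. p \<in> h) H)" .
  qed
  then show ?thesis using sz m_def by blast
qed

lemma fcov_linear:
  assumes d: "1 \<le> d" and k: "k + M = s * Suc d + 1" "1 \<le> M"
    and c: "c = real (Suc d * (\<Sum>r<s. s - r)) / real M" and l: "lower_slope (Suc d) k c"
  shows "\<exists>K. \<forall>n\<ge>1. \<bar>real (fcov n d k) - c * real n\<bar> \<le> K"
proof -
  define Q where "Q = real (Suc d * (\<Sum>r<s. s - r))"
  obtain K where K: "\<And>n H. 1 \<le> n \<Longrightarrow> is_kcover n d k H \<Longrightarrow> c * real n - K \<le> real (size H)"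
    using kcover_size_lower[OF l] by blast
  \<comment> \<open>\<open>K\<close> serves the lower bound; \<open>Q\<close> pays for rounding the
    block length \<open>m\<close> up to an integer.\<close>
  show ?thesis
  proof (intro exI[of _ "max K Q"] allI impI)
    fix n :: nat assume n: "1 \<le> n"
    obtain H where H: "is_kcover n d k H" "size H = Suc d * ((\<Sum>r<s. s - r) * Suc ((n - 1) div M))"
      using kcover_exists[OF d n k] by blast
    have "\<exists>H'. is_kcover n d k H' \<and> size H' = fcov n d k"
      unfolding fcov_def by (rule LeastI_ex) (use H in blast)
    then have "c * real n - K \<le> real (fcov n d k)" using K[OF n] by metis
    moreover have "real (fcov n d k) \<le> c * real n + Q"
    proof -
      have "fcov n d k \<le> size H" unfolding fcov_def by (rule Least_le) (use H in blast)
      then have "real (fcov n d k) \<le> Q * real (Suc ((n - 1) div M))"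
        unfolding H(2) Q_def by (metis mult.assoc of_nat_le_iff of_nat_mult)
      also have "\<dots> \<le> Q * (real n / real M + 1)"
      proof (rule mult_left_mono)
        have "real ((n - 1) div M) \<le> real (n - 1) / real M" by (rule of_nat_div_le_of_nat)
        also have "\<dots> \<le> real n / real M" by (simp add: divide_right_mono)
        finally show "real (Suc ((n - 1) div M)) \<le> real n / real M + 1" by simp
      qed (simp only: Q_def of_nat_0_le_iff)
      also have "\<dots> = c * real n + Q" unfolding c Q_def[symmetric] by (simp add: algebra_simps)
      finally show ?thesis .
    qed
    ultimately show "\<bar>real (fcov n d k) - c * real n\<bar> \<le> max K Q" by linarith
  qed
qed

theorem mainTheorem11:
  shows "(\<forall>k d :: nat. k \<ge> 2 \<and> int d \<ge> 2 * int k - 3 \<longrightarrow>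
            (\<exists>K :: real. \<forall>n \<ge> 1.
               \<bar>real (fcov n d k) - (1 + (real k - 1) / (real d - real k + 2)) * real n\<bar> \<le> K))
       \<and> (\<forall>k d :: nat. k \<ge> 3 \<and> int k - 2 \<le> int d \<and> int d \<le> 2 * int k - 3 \<longrightarrow>
            (\<exists>K :: real. \<forall>n \<ge> 1.
               \<bar>real (fcov n d k) - (2 + (2 * real k - 3 - real d) / (2 * real d + 3 - real k)) * real n\<bar> \<le> K))"
proof (intro conjI allI impI)
  fix k d :: nat assume "k \<ge> 2 \<and> int d \<ge> 2 * int k - 3"
  then have kd: "k \<ge> 2" "2 * k \<le> d + 3" by linarith+
  have M: "real (d + 2 - k) = real d + 2 - real k" "real d + 2 - real k > 0" using kd by (auto simp: of_nat_diff)
  have c: "1 + (real k - 1) / (real d - real k + 2) = real (Suc d) / (real (Suc d) + 1 - real k)"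
    using M(2) by (simp add: field_simps)
  show "\<exists>K :: real. \<forall>n \<ge> 1. \<bar>real (fcov n d k) - (1 + (real k - 1) / (real d - real k + 2)) * real n\<bar> \<le> K"
    unfolding c
  proof (rule fcov_linear[of d k "d + 2 - k" 1])
    \<comment> \<open>\<open>s = 1\<close>: one block of length \<open>m\<close> per coordinate,
      each hyperplane taken once.\<close>
    show "real (Suc d) / (real (Suc d) + 1 - real k) = real (Suc d * (\<Sum>r<1. 1 - r)) / real (d + 2 - k)"
      unfolding M(1) by simp
    show "lower_slope (Suc d) k (real (Suc d) / (real (Suc d) + 1 - real k))"
      by (rule lower_slope_above) (use kd in auto)
  qed (use kd in auto)
next
  fix k d :: nat assume "k \<ge> 3 \<and> int k - 2 \<le> int d \<and> int d \<le> 2 * int k - 3"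
  then have kd: "k \<ge> 3" "k \<le> d + 2" "d + 3 \<le> 2 * k" by linarith+
  have M: "real (2 * d + 3 - k) = 2 * real d + 3 - real k" "2 * real d + 3 - real k > 0"
    using kd by (auto simp: of_nat_diff)
  have c: "2 + (2 * real k - 3 - real d) / (2 * real d + 3 - real k) = 3 * real (Suc d) / (2 * real (Suc d) + 1 - real k)"
    using M(2) by (simp add: field_simps)
  show "\<exists>K :: real. \<forall>n \<ge> 1. \<bar>real (fcov n d k) - (2 + (2 * real k - 3 - real d) / (2 * real d + 3 - real k)) * real n\<bar> \<le> K"
    unfolding c
  proof (rule fcov_linear[of d k "2 * d + 3 - k" 2])
    \<comment> \<open>\<open>s = 2\<close>: per coordinate a block of double hyperplanes and a block
      of single ones, whence the factor \<open>3 = 2 + 1\<close>.\<close>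
    have "real (Suc d * (\<Sum>r<2. 2 - r)) = 3 * real (Suc d)" by (simp add: numeral_2_eq_2)
    then show "3 * real (Suc d) / (2 * real (Suc d) + 1 - real k) = real (Suc d * (\<Sum>r<2. 2 - r)) / real (2 * d + 3 - k)"
      unfolding M(1) by simp
    show "lower_slope (Suc d) k (3 * real (Suc d) / (2 * real (Suc d) + 1 - real k))"
      by (rule lower_slope_below) (use kd in auto)
  qed (use kd in auto)
qed

end
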